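(* Let $\delta\in[1,\infty)$, let $H$ be a graph and $G$ an $s$-$t$ graph, let $\nu_H$ and $\nu_G$ be fully supported probability measures on $E(H)$ and $E(G)$ respectively, and let $\mathsf d_H$, $\mathsf d_G$ be geodesic metrics on $V(H)$, $V(G)$ respectively, with $\mathsf d_G$ normalized, i.e. $\mathsf d_G(s(G),t(G))=1$. Then $$\min_{\emptyset\ne S\subsetneq V(H\oslash G)}\ \inf_{\alpha\in(0,1)^{E(H\oslash G)}}q_{H\oslash G,\alpha}(S)\ \ge\ \min\big\{\rho_H\cdot\tilde q_G^{\circ},\ q_H\cdot p_G\big\},$$ where $$\rho_H=\min_{e\in E(H)}\frac{\nu_H(e)^{1/\delta}}{\mathsf d_H(e)},\qquad \tilde q_G^\circ=\min_{\substack{\emptyset\neq S\subset V(G)\\ S\cap\{s(G),t(G)\}=\emptyset}}\ \inf_{\alpha\in(0,1)^{E(G)}}\tilde q_{G,\alpha}(S),$$ $$q_H=\min_{\emptyset\ne S\subsetneq V(H)}\ \inf_{\alpha\in(0,1)^{E(H)}}q_{H,\alpha}(S),\qquad p_G=\min_{\substack{S\subset V(G)\\|S\cap\{s(G),t(G)\}|=1}}\mathrm{Per}_G(S).$$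
   Context: **Graphs.** Graphs are finite, connected, directed, with at least one edge, without self-loops or multiple edges between the same pair of vertices. For $e=(u,v)\in E(G)$, $e^-=u$, $e^+=v$. A metric $\mathsf d$ on $V(G)$ is geodesic if any $x,y$ are joined by a path (edges traversed in either direction) $u_0=x,\dots,u_k=y$ with $\mathsf d(x,y)=\sum_i\mathsf d(u_{i-1},u_i)$; $\mathsf d(e)=\mathsf d(e^-,e^+)$. An $s$-$t$ graph is a graph $G$ with two distinct distinguished vertices $s(G),t(G)$ such that every vertex lies on a directed path from $s(G)$ to $t(G)$. **$\oslash$-product.** $V(H\oslash G)=E(H)\times V(G)/\sim$, where $(e_1,u_1)\sim(e_2,u_2)$ iff they are equal, or $u_1,u_2\in\{s(G),t(G)\}$ and the corresponding endpoints in $H$ coincide ($(e,s(G))$ corresponds to $e^-$, $(e,t(G))$ to $e^+$). The class of $(e,u)$ is $e\oslash u$; the edges of $H\oslash G$ are $e\oslash f:=(e\oslash f^-,e\oslash f^+)$ for $(e,f)\in E(H)\times E(G)$. $E(H\oslash G)$ carries $(\nu_H\oslash\nu_G)(e\oslash f)=\nu_H(e)\nu_G(f)$, and $V(H\oslash G)$ carries the unique geodesic metric $\mathsf d_H\oslash\mathsf d_G$ with $(\mathsf d_H\oslash\mathsf d_G)(e\oslash f)=\mathsf d_H(e)\mathsf d_G(f)$. **Ratios.** Let $K\in\{H,G,H\oslash G\}$, and let $(\nu,\mathsf d)$ denote the corresponding edge measure and vertex metric, namely $(\nu,\mathsf d)=(\nu_H,\mathsf d_H)$ if $K=H$, $(\nu,\mathsf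 d)=(\nu_G,\mathsf d_G)$ if $K=G$, and $(\nu,\mathsf d)=(\nu_H\oslash\nu_G,\mathsf d_H\oslash\mathsf d_G)$ if $K=H\oslash G$. For $S\subset V(K)$, $\partial_KS=\{(x,y)\in E(K):|\{x,y\}\cap S|=1\}$ and $\mathrm{Per}_K(S)=\sum_{e\in\partial_KS}\nu(e)/\mathsf d(e)$. For $\alpha=(\alpha(e))_{e\in E(K)}\in(0,1)^{E(K)}$, $\mu_\alpha(\nu)$ is the probability measure on $V(K)$ given by $\mu_\alpha(\nu)(x)=\sum_{e^+=x}\nu(e)\alpha(e)+\sum_{e^-=x}\nu(e)(1-\alpha(e))$. Set $$q_{K,\alpha}(S)=\frac{\mathrm{Per}_K(S)}{\min\{\mu_\alpha(\nu)(S),\mu_\alpha(\nu)(S^c)\}^{\frac{\delta-1}\delta}}\ (\emptyset\ne S\subsetneq V(K)),\qquad \tilde q_{K,\alpha}(S)=\frac{\mathrm{Per}_K(S)}{\mu_\alpha(\nu)(S)^{\frac{\delta-1}\delta}}\ (S\ne\emptyset).$$ A minimum over an empty collection of sets is $+\infty$. *)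

theory Defs
  imports "HOL-Probability.Probability" "Graph_Theory.Graph_Theory"
begin

text \<open>
  Together with loop-freeness, antisymmetry of the arc relation says that an unordered pair of
  vertices carries at most one arc, so antiparallel arcs are excluded as well. (They have to be: if
  \<open>(u, v)\<close>, \<open>(v, u)\<close> are arcs of \<open>H\<close> and \<open>(s, t)\<close>, \<open>(t, s)\<close> are arcs of \<open>G\<close>, two different pairs of
  arcs give the same arc of the product \<open>H \<oslash> G\<close>, whose edge weights would be ill-defined.)
\<close>

locale oriented_graph = pair_digraph G for G :: "'v pair_pre_digraph" +
  assumes connected: "Digraph_Component.connected (with_proj G)"
    and arcs_nonempty: "parcs G \<noteq> {}"
    and antisym_arcs: "antisym (parcs G)"

locale st_graph = oriented_graph G for G :: "'v pair_pre_digraph" and s t :: 'v +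
  assumes s_in: "s \<in> pverts G" and t_in: "t \<in> pverts G" and s_neq_t: "s \<noteq> t"
    and on_st_path: "x \<in> pverts G \<Longrightarrow>
      \<exists>p. vwalk p (with_proj G) \<and> hd p = s \<and> last p = t \<and> x \<in> set p"


definition geodesic_metric :: "'v pair_pre_digraph \<Rightarrow> ('v \<Rightarrow> 'v \<Rightarrow> real) \<Rightarrow> bool" where
  "geodesic_metric K d \<longleftrightarrow> Metric_space (pverts K) d \<and>
     (\<forall>x\<in>pverts K. \<forall>y\<in>pverts K. \<exists>p.
        vwalk p (with_proj (mk_symmetric (with_proj K))) \<and> hd p = x \<and> last p = y \<and>
        d x y = (\<Sum>(u, v)\<leftarrow>vwalk_arcs p. d u v))"

definition edge_length :: "('v \<Rightarrow> 'v \<Rightarrow> real) \<Rightarrow> 'v \<times> 'v \<Rightarrow> real" where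
  "edge_length d e = d (fst e) (snd e)"


section \<open>The product of a graph with an s-t graph\<close>

definition slash_end :: "'b \<Rightarrow> 'a \<times> 'a \<Rightarrow> 'b \<Rightarrow> 'a" where
  "slash_end s e u = (if u = s then fst e else snd e)"

definition slash_rel ::
    "'a pair_pre_digraph \<Rightarrow> 'b pair_pre_digraph \<Rightarrow> 'b \<Rightarrow> 'b \<Rightarrow> (('a \<times> 'a) \<times> 'b) rel" where
  "slash_rel H G s t = {((e1, u1), (e2, u2)).
     e1 \<in> parcs H \<and> u1 \<in> pverts G \<and> e2 \<in> parcs H \<and> u2 \<in> pverts G \<and>
     ((e1, u1) = (e2, u2) \<or>
      u1 \<in> {s, t} \<and> u2 \<in> {s, t} \<and> slash_end s e1 u1 = slash_end s e2 u2)}"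

definition slash_vertex ::
    "'a pair_pre_digraph \<Rightarrow> 'b pair_pre_digraph \<Rightarrow> 'b \<Rightarrow> 'b \<Rightarrow> 'a \<times> 'a \<Rightarrow> 'b \<Rightarrow>
     (('a \<times> 'a) \<times> 'b) set" where
  "slash_vertex H G s t e u = slash_rel H G s t `` {(e, u)}"

definition slash_edge ::
    "'a pair_pre_digraph \<Rightarrow> 'b pair_pre_digraph \<Rightarrow> 'b \<Rightarrow> 'b \<Rightarrow> 'a \<times> 'a \<Rightarrow> 'b \<times> 'b \<Rightarrow>
     (('a \<times> 'a) \<times> 'b) set \<times> (('a \<times> 'a) \<times> 'b) set" where
  "slash_edge H G s t e f = (slash_vertex H G s t e (fst f), slash_vertex H G s t e (snd f))"

definition slash_graph ::
    "'a pair_pre_digraph \<Rightarrow> 'b pair_pre_digraph \<Rightarrow> 'b \<Rightarrow> 'b \<Rightarrow>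
     (('a \<times> 'a) \<times> 'b) set pair_pre_digraph" where
  "slash_graph H G s t =
     \<lparr> pverts = (parcs H \<times> pverts G) // slash_rel H G s t,
       parcs = (\<lambda>(e, f). slash_edge H G s t e f) ` (parcs H \<times> parcs G) \<rparr>"

text \<open>
  The push-forward of the product measure along \<open>(e, f) \<mapsto> e \<oslash> f\<close>, which is injective on
  \<open>E(H) \<times> E(G)\<close>; see \<open>pmf_slash_measure\<close> below for the resulting edge weights.
\<close>

definition slash_measure ::
    "'a pair_pre_digraph \<Rightarrow> 'b pair_pre_digraph \<Rightarrow> 'b \<Rightarrow> 'b \<Rightarrow>
     ('a \<times> 'a) pmf \<Rightarrow> ('b \<times> 'b) pmf \<Rightarrow>
     ((('a \<times> 'a) \<times> 'b) set \<times> (('a \<times> 'a) \<times> 'b) set) pmf" where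
  "slash_measure H G s t \<nu>H \<nu>G =
     map_pmf (\<lambda>(e, f). slash_edge H G s t e f) (pair_pmf \<nu>H \<nu>G)"

text \<open>
  The metric is unique only on the vertex set; the value 0 outside of it is a convention that makes
  it unique as a total function.
\<close>

definition slash_metric ::
    "'a pair_pre_digraph \<Rightarrow> 'b pair_pre_digraph \<Rightarrow> 'b \<Rightarrow> 'b \<Rightarrow>
     ('a \<Rightarrow> 'a \<Rightarrow> real) \<Rightarrow> ('b \<Rightarrow> 'b \<Rightarrow> real) \<Rightarrow>
     (('a \<times> 'a) \<times> 'b) set \<Rightarrow> (('a \<times> 'a) \<times> 'b) set \<Rightarrow> real" where
  "slash_metric H G s t dH dG = (THE d.
     geodesic_metric (slash_graph H G s t) d \<and>
     (\<forall>e\<in>parcs H. \<forall>f\<in>parcs G.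
        edge_length d (slash_edge H G s t e f) = edge_length dH e * edge_length dG f) \<and>
     (\<forall>x y. \<not> (x \<in> pverts (slash_graph H G s t) \<and> y \<in> pverts (slash_graph H G s t)) \<longrightarrow>
        d x y = 0))"


section \<open>Isoperimetric ratios\<close>

definition edge_boundary :: "'v pair_pre_digraph \<Rightarrow> 'v set \<Rightarrow> ('v \<times> 'v) set" where
  "edge_boundary K S = {(x, y) \<in> parcs K. card ({x, y} \<inter> S) = 1}"

definition Per ::
    "'v pair_pre_digraph \<Rightarrow> ('v \<times> 'v) pmf \<Rightarrow> ('v \<Rightarrow> 'v \<Rightarrow> real) \<Rightarrow> 'v set \<Rightarrow> real" where
  "Per K \<nu> d S = (\<Sum>e\<in>edge_boundary K S. pmf \<nu> e / edge_length d e)"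

definition vertex_mass ::
    "'v pair_pre_digraph \<Rightarrow> ('v \<times> 'v) pmf \<Rightarrow> ('v \<times> 'v \<Rightarrow> real) \<Rightarrow> 'v \<Rightarrow> real" where
  "vertex_mass K \<nu> \<alpha> x =
     (\<Sum>e | e \<in> parcs K \<and> snd e = x. pmf \<nu> e * \<alpha> e) +
     (\<Sum>e | e \<in> parcs K \<and> fst e = x. pmf \<nu> e * (1 - \<alpha> e))"

definition vertex_measure ::
    "'v pair_pre_digraph \<Rightarrow> ('v \<times> 'v) pmf \<Rightarrow> ('v \<times> 'v \<Rightarrow> real) \<Rightarrow> 'v set \<Rightarrow> real" where
  "vertex_measure K \<nu> \<alpha> S = (\<Sum>x\<in>S. vertex_mass K \<nu> \<alpha> x)"

definition iso_ratio ::
    "real \<Rightarrow> 'v pair_pre_digraph \<Rightarrow> ('v \<times> 'v) pmf \<Rightarrow> ('v \<Rightarrow> 'v \<Rightarrow> real) \<Rightarrow>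
     ('v \<times> 'v \<Rightarrow> real) \<Rightarrow> 'v set \<Rightarrow> real" where
  "iso_ratio \<delta> K \<nu> d \<alpha> S = Per K \<nu> d S /
     (min (vertex_measure K \<nu> \<alpha> S) (vertex_measure K \<nu> \<alpha> (pverts K - S))) powr ((\<delta> - 1) / \<delta>)"

definition iso_ratio' ::
    "real \<Rightarrow> 'v pair_pre_digraph \<Rightarrow> ('v \<times> 'v) pmf \<Rightarrow> ('v \<Rightarrow> 'v \<Rightarrow> real) \<Rightarrow>
     ('v \<times> 'v \<Rightarrow> real) \<Rightarrow> 'v set \<Rightarrow> real" where
  "iso_ratio' \<delta> K \<nu> d \<alpha> S = Per K \<nu> d S / (vertex_measure K \<nu> \<alpha> S) powr ((\<delta> - 1) / \<delta>)"

text \<open>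
  The outer infima below range over finite families, so they are minima; in \<open>ereal\<close> the infimum of
  the empty family is \<open>\<infinity>\<close>, which matters for \<open>q_circ\<close> when \<open>V(G) = {s, t}\<close>.
\<close>

definition q_const ::
    "real \<Rightarrow> 'v pair_pre_digraph \<Rightarrow> ('v \<times> 'v) pmf \<Rightarrow> ('v \<Rightarrow> 'v \<Rightarrow> real) \<Rightarrow> ereal" where
  "q_const \<delta> K \<nu> d = (INF S\<in>{S. S \<noteq> {} \<and> S \<subset> pverts K}.
     INF \<alpha>\<in>parcs K \<rightarrow>\<^sub>E {0<..<1}. ereal (iso_ratio \<delta> K \<nu> d \<alpha> S))"

definition q_circ ::
    "real \<Rightarrow> 'v pair_pre_digraph \<Rightarrow> 'v \<Rightarrow> 'v \<Rightarrow> ('v \<times> 'v) pmf \<Rightarrow> ('v \<Rightarrow> 'v \<Rightarrow> real) \<Rightarrow> ereal" where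
  "q_circ \<delta> K s t \<nu> d = (INF S\<in>{S. S \<noteq> {} \<and> S \<subseteq> pverts K \<and> S \<inter> {s, t} = {}}.
     INF \<alpha>\<in>parcs K \<rightarrow>\<^sub>E {0<..<1}. ereal (iso_ratio' \<delta> K \<nu> d \<alpha> S))"

definition p_const ::
    "'v pair_pre_digraph \<Rightarrow> 'v \<Rightarrow> 'v \<Rightarrow> ('v \<times> 'v) pmf \<Rightarrow> ('v \<Rightarrow> 'v \<Rightarrow> real) \<Rightarrow> ereal" where
  "p_const K s t \<nu> d = (INF S\<in>{S. S \<subseteq> pverts K \<and> card (S \<inter> {s, t}) = 1}. ereal (Per K \<nu> d S))"

definition rho_const ::
    "real \<Rightarrow> 'v pair_pre_digraph \<Rightarrow> ('v \<times> 'v) pmf \<Rightarrow> ('v \<Rightarrow> 'v \<Rightarrow> real) \<Rightarrow> ereal" where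
  "rho_const \<delta> K \<nu> d = (INF e\<in>parcs K. ereal (pmf \<nu> e powr (1 / \<delta>) / edge_length d e))"


section \<open>The product is well defined\<close>

lemma equiv_slash_rel: "equiv (parcs H \<times> pverts G) (slash_rel H G s t)"
  by (rule equivI) (auto simp: slash_rel_def refl_on_def sym_def trans_def)

lemma slash_vertex_eq_iff:
  assumes "e1 \<in> parcs H" "u1 \<in> pverts G" "e2 \<in> parcs H" "u2 \<in> pverts G"
  shows "slash_vertex H G s t e1 u1 = slash_vertex H G s t e2 u2 \<longleftrightarrow>
    (e1, u1) = (e2, u2) \<or>
    u1 \<in> {s, t} \<and> u2 \<in> {s, t} \<and> slash_end s e1 u1 = slash_end s e2 u2"
  unfolding slash_vertex_def
  using assms by (subst eq_equiv_class_iff[OF equiv_slash_rel]) (auto simp: slash_rel_def)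

lemma inj_on_slash_edge:
  assumes "oriented_graph H" "st_graph G s t"
  shows "inj_on (\<lambda>(e, f). slash_edge H G s t e f) (parcs H \<times> parcs G)"
proof -
  interpret H: oriented_graph H by fact
  interpret G: st_graph G s t by fact
  have "(a, b) = (a', b') \<and> (u, v) = (u', v')"
    if e: "(a, b) \<in> parcs H" "(a', b') \<in> parcs H" and f: "(u, v) \<in> parcs G" "(u', v') \<in> parcs G"
    and eq: "slash_edge H G s t (a, b) (u, v) = slash_edge H G s t (a', b') (u', v')"
    for a b u v a' b' u' v'
  proof -
    have V: "u \<in> pverts G" "v \<in> pverts G" "u' \<in> pverts G" "v' \<in> pverts G"
      using f by (auto dest: G.in_arcsD1 G.in_arcsD2)
    have ne: "u \<noteq> v" "u' \<noteq> v'" "a \<noteq> b" "a' \<noteq> b'"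
      using G.pair_no_loops f H.pair_no_loops e by fastforce+
    have aH: "(x, y) \<in> parcs H \<Longrightarrow> (y, x) \<notin> parcs H" for x y
      using H.antisym_arcs H.pair_no_loops[of "(x, y)"] by (auto dest: antisymD)
    have aG: "(x, y) \<in> parcs G \<Longrightarrow> (y, x) \<notin> parcs G" for x y
      using G.antisym_arcs G.pair_no_loops[of "(x, y)"] by (auto dest: antisymD)
    have "slash_vertex H G s t (a, b) u = slash_vertex H G s t (a', b') u'"
      "slash_vertex H G s t (a, b) v = slash_vertex H G s t (a', b') v'"
      using eq by (auto simp: slash_edge_def)
    then show ?thesis
      using V ne e f aH aG G.s_neq_t
      by (auto simp: slash_vertex_eq_iff slash_end_def split: if_splits)
  qed
  then show ?thesis
    by (fastforce intro!: inj_onI)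
qed

lemma pmf_slash_measure:
  assumes "oriented_graph H" "st_graph G s t" "set_pmf \<nu>H = parcs H" "set_pmf \<nu>G = parcs G"
    and "e \<in> parcs H" "f \<in> parcs G"
  shows "pmf (slash_measure H G s t \<nu>H \<nu>G) (slash_edge H G s t e f) = pmf \<nu>H e * pmf \<nu>G f"
proof -
  let ?h = "\<lambda>(e, f). slash_edge H G s t e f"
  have "inj_on ?h (set_pmf (pair_pmf \<nu>H \<nu>G))"
    using inj_on_slash_edge[OF assms(1,2)] assms(3,4) by simp
  then have "pmf (map_pmf ?h (pair_pmf \<nu>H \<nu>G)) (?h (e, f)) = pmf (pair_pmf \<nu>H \<nu>G) (e, f)"
    using assms by (intro pmf_map_inj) auto
  then show ?thesis by (simp add: slash_measure_def pmf_pair)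
qed

end

theory Submission
  imports Defs
begin

text \<open>
  Both the perimeter and the mass of a vertex set \<open>S\<close> of \<open>H \<oslash> G\<close> split into contributions of the
  copies of \<open>G\<close> replacing the arcs \<open>e\<close> of \<open>H\<close>. Let \<open>T\<close> be the set of vertices of \<open>H\<close> lying in \<open>S\<close>.
  On the copies of arcs in \<open>\<partial>T\<close>, the set \<open>S\<close> separates \<open>s\<close> from \<open>t\<close>, so that these copies contribute
  at least \<open>p_G Per_H(T)\<close> to the perimeter, which is bounded below by the isoperimetric inequality
  in \<open>H\<close>. On the other copies \<open>S\<close> or its complement avoids \<open>{s, t}\<close>, and since
  \<open>\<nu>_H(e) / d_H(e) \<ge> \<rho>_H \<nu>_H(e)^((\<delta>-1)/\<delta>)\<close>, such a copy contributes at least \<open>\<rho>_H q_circ\<close> times the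
  \<open>(\<delta>-1)/\<delta>\<close>-th power of the mass of \<open>S\<close> (or of its complement) there. Subadditivity of
  \<open>x \<mapsto> x powr ((\<delta>-1)/\<delta>)\<close> combines the two bounds.

  The edge lengths of the metric on \<open>H \<oslash> G\<close> are as prescribed because for every arc there is a
  function that is 1-Lipschitz along all arcs and attains the length of the given one; this rules out
  shortcuts in the path metric.
\<close>

section \<open>The path metric of a graph with calibrated edge lengths\<close>


lemma parcs_mk_symmetric_with_proj:
  "parcs (mk_symmetric (with_proj K)) = parcs K \<union> (parcs K)\<inverse>"
  by (force simp: parcs_mk_symmetric)

text \<open>A walk realising \<open>d' x y\<close> has the same length under \<open>d\<close>,
  because the arc lengths agree, and the triangle inequality bounds \<open>d x y\<close> by that
  length. Exchanging the two metrics gives uniqueness.\<close>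

lemma geodesic_metric_le:
  assumes "pair_wf_digraph K" and d: "geodesic_metric K d" and d': "geodesic_metric K d'"
    and eq: "\<And>e. e \<in> parcs K \<Longrightarrow> edge_length d e = edge_length d' e"
    and x: "x \<in> pverts K" and y: "y \<in> pverts K"
  shows "d x y \<le> d' x y"
proof -
  interpret K: pair_wf_digraph K by fact
  interpret M: Metric_space "pverts K" d using d by (simp add: geodesic_metric_def)
  interpret M': Metric_space "pverts K" d' using d' by (simp add: geodesic_metric_def)
  obtain p where p: "vwalk p (with_proj (mk_symmetric (with_proj K)))" "hd p = x" "last p = y"
    and len: "d' x y = (\<Sum>(u, v)\<leftarrow>vwalk_arcs p. d' u v)"
    using d' x y unfolding geodesic_metric_def by blast
  have "d (hd p) (last p) \<le> (\<Sum>(u, v)\<leftarrow>vwalk_arcs p. d' u v) \<and> set p \<subseteq> pverts K"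
    using p(1)
  proof induction
    case (Base u)
    then show ?case by simp
  next
    case (Cons u v es)
    then have arc: "(u, v) \<in> parcs K \<or> (v, u) \<in> parcs K"
      by (simp add: parcs_mk_symmetric_with_proj)
    then have uv: "u \<in> pverts K" "v \<in> pverts K"
      by (auto dest: K.in_arcsD1 K.in_arcsD2)
    have dd: "d u v = d' u v"
      using arc eq[of "(u, v)"] eq[of "(v, u)"]
      unfolding edge_length_def fst_conv snd_conv by (metis M.commute M'.commute)
    have "last (v # es) \<in> set (v # es)" by (rule last_in_set) simp
    then have w: "last (v # es) \<in> pverts K" using Cons.IH by blast
    show ?case
      using Cons.IH M.triangle[OF uv w] uv dd by simp
  qed
  then show ?thesis using p len by simp
qed

text \<open>A calibration of \<open>e\<close> is a dual certificate: its increment along any walk is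
  at most the length of the walk, so no walk from \<open>fst e\<close> to \<open>snd e\<close> is
  shorter than \<open>l e\<close>. Any metric with the arc lengths \<open>l\<close> provides one,
  namely the distance from \<open>fst e\<close>.\<close>

locale calibrated_graph = pair_fin_digraph K for K :: "'v pair_pre_digraph" +
  fixes l :: "'v \<times> 'v \<Rightarrow> real"
  assumes connected: "Digraph_Component.connected (with_proj K)"
    and pos: "e \<in> parcs K \<Longrightarrow> 0 < l e"
    and calibrated: "e \<in> parcs K \<Longrightarrow> \<exists>\<phi>. \<phi> (snd e) - \<phi> (fst e) = l e \<and>
      (\<forall>e'\<in>parcs K. \<bar>\<phi> (snd e') - \<phi> (fst e')\<bar> \<le> l e')"
begin

section \<open>Walks and shortest walks in the underlying undirected graph\<close>

definition sym_length :: "'v \<Rightarrow> 'v \<Rightarrow> real" where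
  "sym_length x y = (if (x, y) \<in> parcs K then l (x, y) else l (y, x))"

definition walk_length :: "'v list \<Rightarrow> real" where
  "walk_length p = (\<Sum>(u, v)\<leftarrow>vwalk_arcs p. sym_length u v)"

definition walks :: "'v \<Rightarrow> 'v \<Rightarrow> 'v list set" where
  "walks x y = {p. vwalk p (with_proj (mk_symmetric (with_proj K))) \<and> hd p = x \<and> last p = y}"

text \<open>The value 0 off the vertex set matches the convention that makes the product metric
  unique as a total function.\<close>

definition path_metric :: "'v \<Rightarrow> 'v \<Rightarrow> real" where
  "path_metric x y = (if x \<in> pverts K \<and> y \<in> pverts K
     then Inf (walk_length ` walks x y) else 0)"

lemma path_metric_outside:
  "\<not> (x \<in> pverts K \<and> y \<in> pverts K) \<Longrightarrow> path_metric x y = 0"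
  unfolding path_metric_def by (rule if_not_P)

text \<open>The calibration of either arc also changes by the length of that arc along the reverse
  one, so each length is at most the other. Hence \<open>sym_length\<close> does not depend on the
  orientation consulted.\<close>

lemma antiparallel_length:
  assumes "(x, y) \<in> parcs K" "(y, x) \<in> parcs K"
  shows "l (x, y) = l (y, x)"
proof -
  have "l (a, b) \<le> l (b, a)" if "(a, b) \<in> parcs K" "(b, a) \<in> parcs K" for a b
    using calibrated[OF that(1)] that(2) by fastforce
  then show ?thesis using assms by (meson order_antisym)
qed

lemma sym_length_commute:
  assumes "(x, y) \<in> parcs (mk_symmetric (with_proj K))"
  shows "sym_length x y = sym_length y x"
  using assms antiparallel_length by (auto simp: sym_length_def parcs_mk_symmetric_with_proj)

lemma sym_length_cases:
  assumes "(x, y) \<in> parcs (mk_symmetric (with_proj K))"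
  obtains e where "e \<in> parcs K" "sym_length x y = l e" "{x, y} = {fst e, snd e}"
  using assms by (fastforce simp: sym_length_def parcs_mk_symmetric_with_proj split: if_splits)

lemma walk_in_verts: "p \<in> walks x y \<Longrightarrow> set p \<subseteq> pverts K \<and> x \<in> pverts K \<and> y \<in> pverts K"
  by (auto simp: walks_def vwalk_def)

lemma walk_length_Cons: "walk_length (u # v # p) = sym_length u v + walk_length (v # p)"
  by (simp add: walk_length_def)

lemma calibration_le_walk_length:
  assumes "p \<in> walks x y" and \<phi>: "\<forall>e'\<in>parcs K. \<bar>\<phi> (snd e') - \<phi> (fst e')\<bar> \<le> l e'"
  shows "\<phi> y - \<phi> x \<le> walk_length p"
proof -
  have "vwalk p (with_proj (mk_symmetric (with_proj K)))"
    using assms by (simp add: walks_def)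
  then have "\<phi> (last p) - \<phi> (hd p) \<le> walk_length p"
  proof induction
    case (Base u)
    then show ?case by (simp add: walk_length_def)
  next
    case (Cons u v es)
    then have "(u, v) \<in> parcs (mk_symmetric (with_proj K))" by simp
    then obtain e where "e \<in> parcs K" "sym_length u v = l e" "{u, v} = {fst e, snd e}"
      by (rule sym_length_cases)
    then have "\<phi> v - \<phi> u \<le> sym_length u v"
      using \<phi>[rule_format, of e] by (auto simp: doubleton_eq_iff abs_le_iff)
    then show ?case using Cons.IH by (simp add: walk_length_Cons)
  qed
  then show ?thesis using assms by (simp add: walks_def)
qed

lemma walks_nonempty:
  assumes "x \<in> pverts K" "y \<in> pverts K"
  shows "walks x y \<noteq> {}"
proof -
  interpret S: pair_wf_digraph "mk_symmetric (with_proj K)" ..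
  have "x \<rightarrow>\<^sup>*\<^bsub>with_proj (mk_symmetric (with_proj K))\<^esub> y"
    using connected assms by (simp add: connected_def strongly_connected_def)
  then show ?thesis
    by (auto simp: walks_def S.reachable_vwalk_conv)
qed

text \<open>The finitely many arc lengths have a positive lower bound, and a list of n vertices
  traverses n - 1 arcs. This limits the number of vertices of short walks and keeps distinct
  vertices at positive distance.\<close>

lemma length_le_walk_length:
  obtains \<epsilon> where "0 < \<epsilon>" "\<And>x y p. p \<in> walks x y \<Longrightarrow> \<epsilon> * (real (length p) - 1) \<le> walk_length p"
proof -
  \<comment> \<open>Inserting 1 keeps \<open>Min\<close> meaningful when there are no arcs.\<close>
  define \<epsilon> where "\<epsilon> = Min (insert 1 (l ` parcs K))"
  have "0 < \<epsilon>" using pos pair_finite_arcs by (auto simp: \<epsilon>_def)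
  moreover have "\<epsilon> * (real (length p) - 1) \<le> walk_length p" if "p \<in> walks x y" for p x y
  proof -
    have "vwalk p (with_proj (mk_symmetric (with_proj K)))"
      using that by (simp add: walks_def)
    then show ?thesis
    proof induction
      case (Base u)
      then show ?case by (simp add: walk_length_def)
    next
      case (Cons u v es)
      then have "(u, v) \<in> parcs (mk_symmetric (with_proj K))" by simp
      then obtain e where "e \<in> parcs K" "sym_length u v = l e" "{u, v} = {fst e, snd e}"
        by (rule sym_length_cases)
      then have "\<epsilon> \<le> sym_length u v"
        using pair_finite_arcs by (auto simp: \<epsilon>_def)
      then show ?case using Cons.IH by (simp add: walk_length_Cons algebra_simps)
    qed
  qed
  ultimately show thesis by (rule that)
qed

text \<open>There may be infinitely many walks from \<open>x\<close> to \<open>y\<close>, but those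
  no longer than a fixed one have boundedly many vertices, so only finitely many compete.\<close>

lemma shortest_walk:
  assumes "x \<in> pverts K" "y \<in> pverts K"
  obtains p where "p \<in> walks x y" "\<And>q. q \<in> walks x y \<Longrightarrow> walk_length p \<le> walk_length q"
proof -
  obtain p0 where p0: "p0 \<in> walks x y" using walks_nonempty[OF assms] by blast
  obtain \<epsilon> where \<epsilon>: "0 < \<epsilon>" "\<And>p. p \<in> walks x y \<Longrightarrow> \<epsilon> * (real (length p) - 1) \<le> walk_length p"
    using length_le_walk_length by metis
  define A where "A = {p \<in> walks x y. walk_length p \<le> walk_length p0}"
  have "A \<subseteq> {p. set p \<subseteq> pverts K \<and> length p \<le> nat \<lceil>walk_length p0 / \<epsilon> + 1\<rceil>}"
  proof (safe)
    fix p u assume "p \<in> A" "u \<in> set p"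
    then show "u \<in> pverts K" using walk_in_verts by (auto simp: A_def)
  next
    fix p assume "p \<in> A"
    then have "\<epsilon> * (real (length p) - 1) \<le> walk_length p0"
      using \<epsilon>(2) by (fastforce simp: A_def)
    then have "real (length p) \<le> walk_length p0 / \<epsilon> + 1"
      using \<epsilon>(1) by (simp add: field_simps)
    then show "length p \<le> nat \<lceil>walk_length p0 / \<epsilon> + 1\<rceil>" by linarith
  qed
  then have "finite A"
    using finite_lists_length_le[OF pair_finite_verts] finite_subset by blast
  moreover have "p0 \<in> A" using p0 by (simp add: A_def)
  ultimately have "Min (walk_length ` A) \<in> walk_length ` A" by (intro Min_in) auto
  then obtain p where p: "p \<in> A" "\<And>q. q \<in> A \<Longrightarrow> walk_length p \<le> walk_length q"
    using \<open>finite A\<close> Min_le[of "walk_length ` A"] by force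
  show thesis
  proof
    show "p \<in> walks x y" using p by (simp add: A_def)
    show "walk_length p \<le> walk_length q" if "q \<in> walks x y" for q
      using p(2)[of q] p(1) that by (cases "walk_length q \<le> walk_length p0") (auto simp: A_def)
  qed
qed

lemma path_metric_attained:
  assumes "x \<in> pverts K" "y \<in> pverts K"
  obtains p where "p \<in> walks x y" "path_metric x y = walk_length p"
proof -
  obtain p where "p \<in> walks x y" "\<And>q. q \<in> walks x y \<Longrightarrow> walk_length p \<le> walk_length q"
    using shortest_walk[OF assms] by blast
  then show thesis using assms
    by (intro that[of p]) (auto simp: path_metric_def intro: cInf_eq_minimum)
qed

lemma path_metric_le:
  assumes "p \<in> walks x y"
  shows "path_metric x y \<le> walk_length p"
proof -
  have "x \<in> pverts K" "y \<in> pverts K" using walk_in_verts assms by auto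
  then obtain q where "\<And>q'. q' \<in> walks x y \<Longrightarrow> walk_length q \<le> walk_length q'"
    using shortest_walk by metis
  then have "bdd_below (walk_length ` walks x y)" by (auto intro!: bdd_belowI)
  then show ?thesis using assms \<open>x \<in> pverts K\<close> \<open>y \<in> pverts K\<close>
    by (auto simp: path_metric_def intro: cInf_lower)
qed

text \<open>The arc itself is a walk of length \<open>l (x, y)\<close>, and its calibration forbids
  anything shorter.\<close>

lemma path_metric_arc:
  assumes "(x, y) \<in> parcs K"
  shows "path_metric x y = l (x, y)"
proof (rule antisym)
  have V: "x \<in> pverts K" "y \<in> pverts K" using assms by (auto dest: in_arcsD1 in_arcsD2)
  have "[x, y] \<in> walks x y"
    using assms V by (auto simp: walks_def vwalk_def parcs_mk_symmetric_with_proj)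
  then show "path_metric x y \<le> l (x, y)"
    using path_metric_le assms by (force simp: walk_length_def sym_length_def)
  obtain p where "p \<in> walks x y" "path_metric x y = walk_length p"
    using path_metric_attained V by blast
  then show "l (x, y) \<le> path_metric x y"
    using calibration_le_walk_length calibrated[OF assms] by fastforce
qed

lemma rev_walks:
  assumes "p \<in> walks x y"
  shows "rev p \<in> walks y x \<and> walk_length (rev p) = walk_length p"
proof -
  have "vwalk p (with_proj (mk_symmetric (with_proj K)))"
    using assms by (simp add: walks_def)
  then have "vwalk (rev p) (with_proj (mk_symmetric (with_proj K))) \<and>
    walk_length (rev p) = walk_length p \<and> last (rev p) = hd p"
  proof induction
    case (Base u)
    then show ?case by simp
  next
    case (Cons u v es)
    then have uv: "(u, v) \<in> parcs (mk_symmetric (with_proj K))" by simp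
    then have "u \<in> pverts K"
      by (auto simp: parcs_mk_symmetric_with_proj dest: in_arcsD1 in_arcsD2)
    have "(v, u) \<in> parcs (mk_symmetric (with_proj K))"
      using uv by (auto simp: parcs_mk_symmetric_with_proj)
    moreover have "vwalk_arcs (rev (v # es) @ [u]) = vwalk_arcs (rev (v # es)) @ [(v, u)]"
      by (subst vwalk_arcs_append) auto
    ultimately show ?case
      using Cons.IH sym_length_commute[OF uv] \<open>u \<in> pverts K\<close>
      by (auto simp: walk_length_def vwalk_def)
  qed
  then show ?thesis
    using assms by (auto simp: walks_def hd_rev last_rev)
qed

lemma join_walks:
  assumes "p \<in> walks x y" "q \<in> walks y z"
  shows "\<exists>r\<in>walks x z. walk_length r = walk_length p + walk_length q"
proof -
  have q: "vwalk q (with_proj (mk_symmetric (with_proj K)))" "last q = z"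
    using assms by (simp_all add: walks_def)
  have "vwalk p (with_proj (mk_symmetric (with_proj K)))"
    using assms by (simp add: walks_def)
  moreover have "last p = hd q" using assms by (simp add: walks_def)
  ultimately have "\<exists>r\<in>walks (hd p) z. walk_length r = walk_length p + walk_length q"
  proof induction
    case (Base u)
    then show ?case using q by (auto simp: walks_def walk_length_def)
  next
    case (Cons u v es)
    then obtain r where r: "r \<in> walks v z" "walk_length r = walk_length (v # es) + walk_length q"
      by auto
    then obtain r' where r': "r = v # r'"
      by (cases r) (auto simp: walks_def vwalk_def)
    have "u \<in> pverts K"
      using Cons(1) by (auto simp: parcs_mk_symmetric_with_proj dest: in_arcsD1 in_arcsD2)
    then have "u # r \<in> walks u z"
      using r(1) r' Cons(1) by (auto simp: walks_def vwalk_def)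
    moreover have "walk_length (u # r) = walk_length (u # v # es) + walk_length q"
      using r r' by (simp add: walk_length_Cons)
    ultimately show ?case by auto
  qed
  then show ?thesis using assms by (auto simp: walks_def)
qed

section \<open>The path metric is geodesic and has the prescribed arc lengths\<close>

lemma path_metric_commute: "path_metric x y = path_metric y x"
proof -
  have "path_metric x y \<le> path_metric y x" if V: "x \<in> pverts K" "y \<in> pverts K" for x y
  proof -
    obtain p where "p \<in> walks y x" "path_metric y x = walk_length p"
      using path_metric_attained V by blast
    then show ?thesis using rev_walks[of p] path_metric_le[of "rev p"] by simp
  qed
  then show ?thesis
    by (cases "x \<in> pverts K \<and> y \<in> pverts K") (auto simp: path_metric_def intro: antisym)
qed

lemma path_metric_zero_iff:
  assumes V: "x \<in> pverts K" "y \<in> pverts K"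
  shows "path_metric x y = 0 \<longleftrightarrow> x = y" and "0 \<le> path_metric x y"
proof -
  obtain p where p: "p \<in> walks x y" "path_metric x y = walk_length p"
    using path_metric_attained V by blast
  obtain \<epsilon> where \<epsilon>: "0 < \<epsilon>" "\<epsilon> * (real (length p) - 1) \<le> walk_length p"
    using length_le_walk_length p(1) by metis
  have "1 \<le> length p" using p(1) by (cases p) (auto simp: walks_def vwalk_def)
  then have "0 \<le> \<epsilon> * (real (length p) - 1)" using \<epsilon>(1) by simp
  then show nonneg: "0 \<le> path_metric x y" using \<epsilon>(2) p(2) by linarith
  show "path_metric x y = 0 \<longleftrightarrow> x = y"
  proof
    assume "path_metric x y = 0"
    then have "\<epsilon> * (real (length p) - 1) \<le> 0" using \<epsilon>(2) p(2) by simp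
    then have "length p = 1"
      using \<epsilon>(1) \<open>1 \<le> length p\<close> by (simp add: mult_le_0_iff)
    then show "x = y" using p(1) by (cases p) (auto simp: walks_def)
  next
    assume "x = y"
    then have "[x] \<in> walks x y" using V by (auto simp: walks_def)
    then have "path_metric x y \<le> 0"
      using path_metric_le by (force simp: walk_length_def)
    then show "path_metric x y = 0" using nonneg by linarith
  qed
qed

lemma geodesic_path_metric: "geodesic_metric K path_metric"
  unfolding geodesic_metric_def
proof (intro conjI ballI)
  show "Metric_space (pverts K) path_metric"
  proof
    show "0 \<le> path_metric x y" for x y
      using path_metric_zero_iff(2)[of x y]
      by (cases "x \<in> pverts K \<and> y \<in> pverts K") (auto simp: path_metric_def)
    show "path_metric x y = path_metric y x" for x y by (rule path_metric_commute)
    show "path_metric x y = 0 \<longleftrightarrow> x = y" if "x \<in> pverts K" "y \<in> pverts K" for x y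
      using path_metric_zero_iff(1) that .
    show "path_metric x z \<le> path_metric x y + path_metric y z"
      if "x \<in> pverts K" "y \<in> pverts K" "z \<in> pverts K" for x y z
    proof -
      obtain p where "p \<in> walks x y" "path_metric x y = walk_length p"
        using path_metric_attained \<open>x \<in> pverts K\<close> \<open>y \<in> pverts K\<close> by blast
      moreover obtain q where "q \<in> walks y z" "path_metric y z = walk_length q"
        using path_metric_attained \<open>y \<in> pverts K\<close> \<open>z \<in> pverts K\<close> by blast
      ultimately show ?thesis using join_walks path_metric_le by metis
    qed
  qed
next
  fix x y assume "x \<in> pverts K" "y \<in> pverts K"
  then obtain p where p: "p \<in> walks x y" "path_metric x y = walk_length p"
    using path_metric_attained by blast
  \<comment> \<open>Each step of a shortest walk has path distance equal to its length, so the same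
    walk witnesses the geodesic property.\<close>
  have "sym_length u v = path_metric u v" if "(u, v) \<in> parcs (mk_symmetric (with_proj K))" for u v
    using that path_metric_arc[of u v] path_metric_arc[of v u] path_metric_commute[of u v]
    by (auto simp: sym_length_def parcs_mk_symmetric_with_proj)
  then have "walk_length p = (\<Sum>(u, v)\<leftarrow>vwalk_arcs p. path_metric u v)"
    using p(1) unfolding walk_length_def
    by (intro arg_cong[where f = sum_list] map_cong) (auto simp: walks_def vwalk_def)
  then show "\<exists>p. vwalk p (with_proj (mk_symmetric (with_proj K))) \<and> hd p = x \<and> last p = y \<and>
      path_metric x y = (\<Sum>(u, v)\<leftarrow>vwalk_arcs p. path_metric u v)"
    using p by (auto simp: walks_def)
qed

lemma ex1_geodesic_metric:
  "\<exists>!d. geodesic_metric K d \<and> (\<forall>e\<in>parcs K. edge_length d e = l e) \<and>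
     (\<forall>x y. \<not> (x \<in> pverts K \<and> y \<in> pverts K) \<longrightarrow> d x y = 0)"
proof (rule ex1I[of _ path_metric])
  show "geodesic_metric K path_metric \<and> (\<forall>e\<in>parcs K. edge_length path_metric e = l e) \<and>
     (\<forall>x y. \<not> (x \<in> pverts K \<and> y \<in> pverts K) \<longrightarrow> path_metric x y = 0)"
    using geodesic_path_metric path_metric_arc by (auto simp: edge_length_def path_metric_outside)
  fix d assume d: "geodesic_metric K d \<and> (\<forall>e\<in>parcs K. edge_length d e = l e) \<and>
     (\<forall>x y. \<not> (x \<in> pverts K \<and> y \<in> pverts K) \<longrightarrow> d x y = 0)"
  have eq: "edge_length d e = edge_length path_metric e" if "e \<in> parcs K" for e
    using d path_metric_arc[of "fst e" "snd e"] that by (simp add: edge_length_def)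
  show "d = path_metric"
  proof (intro ext)
    fix x y
    show "d x y = path_metric x y"
    proof (cases "x \<in> pverts K \<and> y \<in> pverts K")
      case True
      then show ?thesis
        using geodesic_metric_le[OF pair_wf_digraph_axioms _ geodesic_path_metric eq]
          geodesic_metric_le[OF pair_wf_digraph_axioms geodesic_path_metric _ eq[symmetric]] d
        by (intro antisym) blast+
    qed (use d in \<open>simp add: path_metric_outside\<close>)
  qed
qed

end

section \<open>The metric on the product\<close>


lemma (in pair_wf_digraph) connected_invariant:
  fixes P :: "'a \<Rightarrow> bool"
  assumes "Digraph_Component.connected (with_proj G)"
    and P: "\<And>e. e \<in> parcs G \<Longrightarrow> P (fst e) = P (snd e)"
    and "x \<in> pverts G" "y \<in> pverts G"
  shows "P x = P y"
proof -
  interpret S: pair_wf_digraph "mk_symmetric (with_proj G)" ..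
  have "x \<rightarrow>\<^sup>*\<^bsub>with_proj (mk_symmetric (with_proj G))\<^esub> y"
    using assms by (simp add: connected_def strongly_connected_def)
  then show ?thesis
  proof (induction rule: S.reachable_induct)
    case (step x y)
    then have "(x, y) \<in> parcs (mk_symmetric (with_proj G))" by simp
    then have "P x = P y" using P[of "(x, y)"] P[of "(y, x)"] by (auto simp: parcs_mk_symmetric_with_proj)
    then show ?case using step by simp
  qed simp
qed

text \<open>Apply the hypothesis to the predicate of being reachable from \<open>x\<close>. In this
  form connectedness passes to the product without constructing walks there.\<close>

lemma (in pair_wf_digraph) connectedI:
  assumes "pverts G \<noteq> {}"
    and P: "\<And>P x y. \<lbrakk>\<And>e. e \<in> parcs G \<Longrightarrow> P (fst e) = P (snd e); x \<in> pverts G; y \<in> pverts G\<rbrakk>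
      \<Longrightarrow> P x = (P y :: bool)"
  shows "Digraph_Component.connected (with_proj G)"
proof -
  interpret S: pair_wf_digraph "mk_symmetric (with_proj G)" ..
  have "x \<rightarrow>\<^sup>*\<^bsub>with_proj (mk_symmetric (with_proj G))\<^esub> y"
    if V: "x \<in> pverts G" "y \<in> pverts G" for x y
  proof -
    let ?P = "\<lambda>z. x \<rightarrow>\<^sup>*\<^bsub>with_proj (mk_symmetric (with_proj G))\<^esub> z"
    have "?P (fst e) = ?P (snd e)" if "e \<in> parcs G" for e
    proof -
      have "(fst e, snd e) \<in> parcs (mk_symmetric (with_proj G))"
        "(snd e, fst e) \<in> parcs (mk_symmetric (with_proj G))"
        using that by (auto simp: parcs_mk_symmetric_with_proj)
      then show ?thesis using S.reachable_adj_trans by blast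
    qed
    then have "?P x = ?P y" using V by (rule P[of ?P])
    moreover have "?P x" using V by (intro S.reachable_refl) simp
    ultimately show ?thesis by simp
  qed
  then show ?thesis
    using assms(1) by (simp add: connected_def strongly_connected_def)
qed

lemma abs_min_diff_le:
  fixes a b :: real
  assumes "\<bar>a - a'\<bar> \<le> r" "\<bar>b - b'\<bar> \<le> r"
  shows "\<bar>min a b - min a' b'\<bar> \<le> r"
  using assms by linarith

lemma edge_length_pos:
  assumes "oriented_graph K" "geodesic_metric K d" "e \<in> parcs K"
  shows "0 < edge_length d e"
proof -
  interpret oriented_graph K by fact
  interpret M: Metric_space "pverts K" d using assms(2) by (simp add: geodesic_metric_def)
  have "fst e \<in> pverts K" "snd e \<in> pverts K" "fst e \<noteq> snd e"
    using assms(3) arc_fst_in_verts arc_snd_in_verts pair_no_loops by auto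
  then show ?thesis by (simp add: edge_length_def)
qed

section \<open>Gluing and connectedness of the product graph\<close>

locale slash_product = H: oriented_graph H + G: st_graph G s t
  for H :: "'a pair_pre_digraph" and G :: "'b pair_pre_digraph" and s t :: 'b
begin

abbreviation "K \<equiv> slash_graph H G s t"
abbreviation "vert \<equiv> slash_vertex H G s t"

definition trace :: "(('a \<times> 'a) \<times> 'b) set set \<Rightarrow> 'a set" where
  "trace S = {slash_end s e u | e u. e \<in> parcs H \<and> u \<in> {s, t} \<and> vert e u \<in> S}"

lemma pverts_slash: "pverts K = (\<lambda>(e, u). vert e u) ` (parcs H \<times> pverts G)"
  by (auto simp: slash_graph_def slash_vertex_def quotient_def)

lemma parcs_slash: "parcs K = (\<lambda>(e, f). slash_edge H G s t e f) ` (parcs H \<times> parcs G)"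
  by (simp add: slash_graph_def)

lemma slash_edge_in: "e \<in> parcs H \<Longrightarrow> f \<in> parcs G \<Longrightarrow> slash_edge H G s t e f \<in> parcs K"
  by (auto simp: parcs_slash)

lemma vert_in: "e \<in> parcs H \<Longrightarrow> u \<in> pverts G \<Longrightarrow> vert e u \<in> pverts K"
  by (auto simp: pverts_slash)

lemma pair_digraph_slash: "pair_digraph K"
proof
  show "fst x \<in> pverts K" "snd x \<in> pverts K" if "x \<in> parcs K" for x
    using that by (auto simp: parcs_slash slash_edge_def intro!: vert_in dest: G.in_arcsD1 G.in_arcsD2)
  show "finite (pverts K)" "finite (parcs K)"
    using H.pair_finite_arcs G.pair_finite_arcs G.pair_finite_verts
    by (auto simp: parcs_slash pverts_slash)
  show "fst x \<noteq> snd x" if x: "x \<in> parcs K" for x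
  proof -
    obtain e f where ef: "e \<in> parcs H" "f \<in> parcs G" "x = slash_edge H G s t e f"
      using x by (auto simp: parcs_slash)
    then have "fst f \<in> pverts G" "snd f \<in> pverts G" "fst f \<noteq> snd f" "fst e \<noteq> snd e"
      using G.arc_fst_in_verts G.arc_snd_in_verts G.pair_no_loops H.pair_no_loops by auto
    then show ?thesis
      using ef by (auto simp: slash_edge_def slash_vertex_eq_iff slash_end_def)
  qed
qed

text \<open>Any two representatives of the same vertex of \<open>H\<close> are glued, so membership
  does not depend on the arc and end used in \<open>trace\<close>.\<close>

lemma slash_end_in_trace:
  assumes "e \<in> parcs H" "u \<in> {s, t}"
  shows "slash_end s e u \<in> trace S \<longleftrightarrow> vert e u \<in> S"
proof
  show "vert e u \<in> S" if tr: "slash_end s e u \<in> trace S"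
  proof -
    obtain e' u' where e': "e' \<in> parcs H" "u' \<in> {s, t}" "vert e' u' \<in> S"
      "slash_end s e u = slash_end s e' u'"
      using tr unfolding trace_def by blast
    then have "vert e u = vert e' u'"
      using assms G.s_in G.t_in by (subst slash_vertex_eq_iff) auto
    then show ?thesis using e' by simp
  qed
  show "slash_end s e u \<in> trace S" if "vert e u \<in> S"
    using that assms unfolding trace_def by blast
qed

lemma fst_in_trace: "e \<in> parcs H \<Longrightarrow> fst e \<in> trace S \<longleftrightarrow> vert e s \<in> S"
  using slash_end_in_trace[of e s S] by (simp add: slash_end_def)

lemma snd_in_trace: "e \<in> parcs H \<Longrightarrow> snd e \<in> trace S \<longleftrightarrow> vert e t \<in> S"
  using slash_end_in_trace[of e t S] G.s_neq_t by (simp add: slash_end_def)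

lemma trace_subset: "trace S \<subseteq> pverts H"
  by (auto simp: trace_def slash_end_def dest: H.in_arcsD1 H.in_arcsD2 split: if_splits)

text \<open>Two distinct representatives of one class are glued ends, where both values equal
  \<open>A\<close> at the common vertex of \<open>H\<close>; so the representative picked by
  \<open>inv_into\<close> gives the right value. This assembles functions on the single copies of
  \<open>G\<close> into one on the product.\<close>

lemma slash_lift:
  assumes "\<And>e. e \<in> parcs H \<Longrightarrow> g e s = A (fst e)" and "\<And>e. e \<in> parcs H \<Longrightarrow> g e t = A (snd e)"
  obtains \<phi> where "\<And>e u. e \<in> parcs H \<Longrightarrow> u \<in> pverts G \<Longrightarrow> \<phi> (vert e u) = g e u"
proof
  let ?i = "inv_into (parcs H \<times> pverts G) (\<lambda>(e, u). vert e u)"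
  fix e u assume eu: "e \<in> parcs H" "u \<in> pverts G"
  obtain e' u' where i: "?i (vert e u) = (e', u')" by fastforce
  have mem: "vert e u \<in> (\<lambda>(e, u). vert e u) ` (parcs H \<times> pverts G)" using eu by auto
  have eu': "e' \<in> parcs H" "u' \<in> pverts G"
    using inv_into_into[OF mem] i by auto
  have "vert e' u' = vert e u"
    using f_inv_into_f[OF mem] i by simp
  then have "g e' u' = g e u"
    using eu eu' assms[of e] assms[of e'] G.s_neq_t
    by (auto simp: slash_vertex_eq_iff slash_end_def split: if_splits)
  then show "(\<lambda>X. case ?i X of (e, u) \<Rightarrow> g e u) (vert e u) = g e u"
    using i by simp
qed

text \<open>An invariant predicate is constant on each copy of \<open>G\<close>, as \<open>G\<close>
  is connected. It therefore induces a predicate on the vertices of \<open>H\<close> that is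
  constant along arcs, and connectedness of \<open>H\<close> applies.\<close>

lemma connected_slash: "Digraph_Component.connected (with_proj K)"
proof -
  interpret K: pair_digraph K by (rule pair_digraph_slash)
  show ?thesis
  proof (rule K.connectedI)
    show "pverts K \<noteq> {}" using H.arcs_nonempty G.s_in by (auto simp: pverts_slash)
  next
    fix P :: "(('a \<times> 'a) \<times> 'b) set \<Rightarrow> bool" and x y
    assume P: "\<And>e. e \<in> parcs K \<Longrightarrow> P (fst e) = P (snd e)" and xy: "x \<in> pverts K" "y \<in> pverts K"
    have inG: "P (vert e u) = P (vert e w)" if e: "e \<in> parcs H" and uw: "u \<in> pverts G" "w \<in> pverts G"
      for e u w
    proof (rule G.connected_invariant[OF G.connected _ uw])
      show "P (vert e (fst f)) = P (vert e (snd f))" if "f \<in> parcs G" for f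
        using P[OF slash_edge_in[OF e that]] by (simp add: slash_edge_def)
    qed
    define T where "T = trace {x. P x}"
    have T: "fst e \<in> T \<longleftrightarrow> P (vert e s)" "snd e \<in> T \<longleftrightarrow> P (vert e t)" if "e \<in> parcs H" for e
      using that by (simp_all add: T_def fst_in_trace snd_in_trace)
    have inH: "u \<in> T \<longleftrightarrow> v \<in> T" if "u \<in> pverts H" "v \<in> pverts H" for u v
    proof (rule H.connected_invariant[OF H.connected _ that])
      show "fst e \<in> T \<longleftrightarrow> snd e \<in> T" if "e \<in> parcs H" for e
        using T[OF that] inG[OF that G.s_in G.t_in] by simp
    qed
    obtain e u e' u' where "e \<in> parcs H" "u \<in> pverts G" "x = vert e u"
      "e' \<in> parcs H" "u' \<in> pverts G" "y = vert e' u'"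
      using xy by (auto simp: pverts_slash)
    then show "P x = P y"
      using inG[of e u s] inG[of e' u' s] T(1)[of e] T(1)[of e'] G.s_in
        inH[of "fst e" "fst e'"] H.arc_fst_in_verts by simp
  qed
qed

end

section \<open>Calibrations of the product and its metric\<close>

locale metric_slash_product = slash_product H G s t
  for H :: "'a pair_pre_digraph" and G :: "'b pair_pre_digraph" and s t :: 'b +
  fixes dH :: "'a \<Rightarrow> 'a \<Rightarrow> real" and dG :: "'b \<Rightarrow> 'b \<Rightarrow> real"
  assumes geodesic_H: "geodesic_metric H dH" and geodesic_G: "geodesic_metric G dG"
    and normalized: "dG s t = 1"
begin

lemma edge_length_H_pos: "e \<in> parcs H \<Longrightarrow> 0 < edge_length dH e"
  using edge_length_pos[OF H.oriented_graph_axioms geodesic_H] .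

lemma edge_length_G_pos: "f \<in> parcs G \<Longrightarrow> 0 < edge_length dG f"
  using edge_length_pos[OF G.oriented_graph_axioms geodesic_G] .

text \<open>
  The distance to \<open>e \<oslash> u\<close> within the copy of \<open>G\<close> replacing \<open>e\<close>, extended to all of \<open>H \<oslash> G\<close> by the
  McShane formula: first to the vertices of \<open>H\<close>, then to the interior of every other copy.
\<close>

lemma ex_calibration:
  assumes e: "e \<in> parcs H" and u: "u \<in> pverts G"
  obtains \<phi> where "\<And>w. w \<in> pverts G \<Longrightarrow> \<phi> (vert e w) = edge_length dH e * dG u w"
    and "\<And>e' x y. \<lbrakk>e' \<in> parcs H; x \<in> pverts G; y \<in> pverts G\<rbrakk> \<Longrightarrow>
      \<bar>\<phi> (vert e' x) - \<phi> (vert e' y)\<bar> \<le> edge_length dH e' * dG x y"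
proof -
  interpret MH: Metric_space "pverts H" dH using geodesic_H by (simp add: geodesic_metric_def)
  interpret MG: Metric_space "pverts G" dG using geodesic_G by (simp add: geodesic_metric_def)
  define c where "c = edge_length dH e"
  have ab: "fst e \<in> pverts H" "snd e \<in> pverts H" "dH (fst e) (snd e) = c"
    using e H.arc_fst_in_verts H.arc_snd_in_verts by (auto simp: c_def edge_length_def)
  have c: "0 \<le> c" unfolding ab(3)[symmetric] by simp
  define A where "A h = min (dH h (fst e) + c * dG u s) (dH h (snd e) + c * dG u t)" for h
  have ts: "dG t s = 1" using normalized MG.commute by simp
  have st: "s \<in> pverts G" "t \<in> pverts G" by (rule G.s_in, rule G.t_in)
  \<comment> \<open>Since \<open>dG s t = 1\<close>, the values prescribed at the two ends of
    \<open>e\<close> differ by at most \<open>c = dH (fst e) (snd e)\<close>, so the extension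
    \<open>A\<close> keeps them.\<close>
  have "c * dG u s \<le> c * (dG u t + 1)" "c * dG u t \<le> c * (dG u s + 1)"
    using MG.triangle[of u t s] MG.triangle[of u s t] ts normalized u st c
    by (auto intro!: mult_left_mono)
  then have A_ends: "A (fst e) = c * dG u s" "A (snd e) = c * dG u t"
    using ab MH.commute[of "snd e" "fst e"] by (auto simp: A_def algebra_simps)
  have A_lip: "\<bar>A h - A h'\<bar> \<le> dH h h'" if "h \<in> pverts H" "h' \<in> pverts H" for h h'
    unfolding A_def
  proof (rule abs_min_diff_le)
    have "\<bar>dH h z - dH h' z\<bar> \<le> dH h h'" if "z \<in> pverts H" for z
      using MH.triangle[of h h' z] MH.triangle[of h' h z] MH.commute[of h h']
        \<open>h \<in> pverts H\<close> \<open>h' \<in> pverts H\<close> that by linarith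
    then show "\<bar>dH h (fst e) + c * dG u s - (dH h' (fst e) + c * dG u s)\<bar> \<le> dH h h'"
      "\<bar>dH h (snd e) + c * dG u t - (dH h' (snd e) + c * dG u t)\<bar> \<le> dH h h'"
      using ab by simp_all
  qed
  define g where "g e' w = (if e' = e then c * dG u w
    else min (A (fst e') + edge_length dH e' * dG s w) (A (snd e') + edge_length dH e' * dG t w))"
    for e' w
  have A_arc: "\<bar>A (fst e') - A (snd e')\<bar> \<le> edge_length dH e'" if "e' \<in> parcs H" for e'
    using A_lip[of "fst e'" "snd e'"] that H.arc_fst_in_verts H.arc_snd_in_verts
    by (simp add: edge_length_def)
  \<comment> \<open>The values of \<open>A\<close> at the ends of \<open>e'\<close> differ by at
    most the length of \<open>e'\<close>, which is the scaled distance from \<open>s\<close> to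
    \<open>t\<close>. Hence the extension into the copy keeps them, and the copies can be
    glued.\<close>
  have "g e' s = A (fst e')" "g e' t = A (snd e')" if "e' \<in> parcs H" for e'
    using A_arc[OF that] A_ends ts normalized st by (auto simp: g_def)
  then obtain \<phi> where \<phi>: "\<And>e u. e \<in> parcs H \<Longrightarrow> u \<in> pverts G \<Longrightarrow> \<phi> (vert e u) = g e u"
    using slash_lift[of g A] by blast
  show thesis
  proof
    show "\<phi> (vert e w) = edge_length dH e * dG u w" if "w \<in> pverts G" for w
      using \<phi> e that by (simp add: g_def c_def)
    show "\<bar>\<phi> (vert e' x) - \<phi> (vert e' y)\<bar> \<le> edge_length dH e' * dG x y"
      if e': "e' \<in> parcs H" and x: "x \<in> pverts G" and y: "y \<in> pverts G" for e' x y
    proof -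
      let ?L = "edge_length dH e'"
      have L: "0 \<le> ?L" using edge_length_H_pos[OF e'] by simp
      have lip: "\<bar>?L * dG z x - ?L * dG z y\<bar> \<le> ?L * dG x y" if "z \<in> pverts G" for z
      proof -
        have "\<bar>dG z x - dG z y\<bar> \<le> dG x y"
          using MG.triangle[of z x y] MG.triangle[of z y x] MG.commute[of x y] that x y by auto
        then show ?thesis
          using L by (simp add: abs_mult mult_left_mono flip: right_diff_distrib)
      qed
      have "\<bar>g e' x - g e' y\<bar> \<le> ?L * dG x y"
      proof (cases "e' = e")
        case True
        then show ?thesis using lip[OF u] by (simp add: g_def c_def)
      next
        case False
        then show ?thesis using lip[OF st(1)] lip[OF st(2)]
          unfolding g_def by (simp add: abs_min_diff_le)
      qed
      then show ?thesis using \<phi> e' x y by simp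
    qed
  qed
qed

lemma slash_metric:
  assumes "e \<in> parcs H" "f \<in> parcs G"
  shows "edge_length (slash_metric H G s t dH dG) (slash_edge H G s t e f) =
    edge_length dH e * edge_length dG f"
proof -
  interpret K: pair_digraph K by (rule pair_digraph_slash)
  let ?h = "\<lambda>(e, f). slash_edge H G s t e f"
  \<comment> \<open>Distinct pairs give distinct product arcs, so the product of the lengths is a
    well-defined function of the arc.\<close>
  define l where "l a = (case the_inv_into (parcs H \<times> parcs G) ?h a of
    (e, f) \<Rightarrow> edge_length dH e * edge_length dG f)" for a
  have l: "l (slash_edge H G s t e f) = edge_length dH e * edge_length dG f"
    if "e \<in> parcs H" "f \<in> parcs G" for e f
    using the_inv_into_f_f[OF inj_on_slash_edge[OF H.oriented_graph_axioms G.st_graph_axioms], of "(e, f)"]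
      that by (simp add: l_def)
  interpret C: calibrated_graph K l
  proof
    show "Digraph_Component.connected (with_proj K)" by (rule connected_slash)
    show "0 < l a" if "a \<in> parcs K" for a
      using that l edge_length_H_pos edge_length_G_pos by (auto simp: parcs_slash)
    show "\<exists>\<phi>. \<phi> (snd a) - \<phi> (fst a) = l a \<and> (\<forall>a'\<in>parcs K. \<bar>\<phi> (snd a') - \<phi> (fst a')\<bar> \<le> l a')"
      if a: "a \<in> parcs K" for a
    proof -
      interpret MG: Metric_space "pverts G" dG using geodesic_G by (simp add: geodesic_metric_def)
      obtain e f where ef: "e \<in> parcs H" "f \<in> parcs G" "a = slash_edge H G s t e f"
        using a by (auto simp: parcs_slash)
      have f: "fst f \<in> pverts G" "snd f \<in> pverts G"
        using ef G.arc_fst_in_verts G.arc_snd_in_verts by auto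
      obtain \<phi> where \<phi>: "\<And>w. w \<in> pverts G \<Longrightarrow> \<phi> (vert e w) = edge_length dH e * dG (fst f) w"
        "\<And>e' x y. \<lbrakk>e' \<in> parcs H; x \<in> pverts G; y \<in> pverts G\<rbrakk> \<Longrightarrow>
          \<bar>\<phi> (vert e' x) - \<phi> (vert e' y)\<bar> \<le> edge_length dH e' * dG x y"
        using ex_calibration[OF ef(1) f(1)] by metis
      \<comment> \<open>The calibration is based at \<open>fst f\<close>: it vanishes at the tail of
        \<open>a\<close> and equals the product of the two lengths at its head.\<close>
      have "\<phi> (snd a) - \<phi> (fst a) = l a"
        using \<phi>(1) f ef l by (simp add: slash_edge_def edge_length_def)
      moreover have "\<bar>\<phi> (snd a') - \<phi> (fst a')\<bar> \<le> l a'" if a': "a' \<in> parcs K" for a'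
      proof -
        obtain e' f' where ef': "e' \<in> parcs H" "f' \<in> parcs G" "a' = slash_edge H G s t e' f'"
          using a' by (auto simp: parcs_slash)
        then show ?thesis
          using \<phi>(2)[of e' "fst f'" "snd f'"] l[of e' f'] G.arc_fst_in_verts G.arc_snd_in_verts
          by (simp add: slash_edge_def edge_length_def abs_minus_commute)
      qed
      ultimately show ?thesis by blast
    qed
  qed
  have "(\<forall>e\<in>parcs H. \<forall>f\<in>parcs G.
      edge_length d (slash_edge H G s t e f) = edge_length dH e * edge_length dG f) \<longleftrightarrow>
    (\<forall>a\<in>parcs K. edge_length d a = l a)" for d
    using l by (auto simp: parcs_slash)
  then have "slash_metric H G s t dH dG = (THE d. geodesic_metric K d \<and>
      (\<forall>a\<in>parcs K. edge_length d a = l a) \<and>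
      (\<forall>x y. \<not> (x \<in> pverts K \<and> y \<in> pverts K) \<longrightarrow> d x y = 0))"
    unfolding slash_metric_def by (simp only:)
  then have "\<forall>a\<in>parcs K. edge_length (slash_metric H G s t dH dG) a = l a"
    using theI'[OF C.ex1_geodesic_metric] by simp
  then show ?thesis using assms l by (auto simp: parcs_slash)
qed

end

section \<open>Isoperimetry in the product\<close>


text \<open>The fractions \<open>x / (x + y)\<close> and \<open>y / (x + y)\<close> add up to 1 and
  lie in (0, 1], where raising to a power at most 1 does not decrease them. If \<open>x\<close> or
  \<open>y\<close> is 0, use \<open>0 powr a = 0\<close>, which includes
  \<open>a = 0\<close>.\<close>

lemma powr_add_le:
  fixes x y a :: real
  assumes "0 \<le> x" "0 \<le> y" "a \<le> 1"
  shows "(x + y) powr a \<le> x powr a + y powr a"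
proof (cases "x = 0 \<or> y = 0")
  case False
  then have pos: "0 < x" "0 < y" using assms by auto
  have *: "z / (x + y) \<le> (z / (x + y)) powr a" if "0 < z" "z \<le> x + y" for z
    using powr_mono'[of a 1 "z / (x + y)"] that assms(3) pos by simp
  have "1 = x / (x + y) + y / (x + y)" using pos by (simp flip: add_divide_distrib)
  also have "\<dots> \<le> (x / (x + y)) powr a + (y / (x + y)) powr a"
    using *[of x] *[of y] pos by simp
  also have "\<dots> = (x powr a + y powr a) / (x + y) powr a"
    using pos by (simp add: powr_divide add_divide_distrib)
  finally show ?thesis using pos by (simp add: field_simps)
qed auto

lemma powr_sum_le:
  fixes f :: "'i \<Rightarrow> real"
  assumes "finite A" "\<And>i. i \<in> A \<Longrightarrow> 0 \<le> f i" "a \<le> 1"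
  shows "(\<Sum>i\<in>A. f i) powr a \<le> (\<Sum>i\<in>A. f i powr a)"
  using assms
proof (induction A rule: finite_induct)
  case (insert x F)
  have "(f x + (\<Sum>i\<in>F. f i)) powr a \<le> f x powr a + (\<Sum>i\<in>F. f i) powr a"
    using insert.prems by (intro powr_add_le sum_nonneg) auto
  then show ?case using insert by fastforce
qed simp

text \<open>If no arc met \<open>x\<close>, equality with \<open>x\<close> would be constant along
  arcs, and connectedness would force the tail of every arc to be \<open>x\<close>.\<close>

lemma (in pair_wf_digraph) ex_incident_arc:
  assumes "Digraph_Component.connected (with_proj G)" "parcs G \<noteq> {}" "x \<in> pverts G"
  shows "\<exists>e\<in>parcs G. x = fst e \<or> x = snd e"
proof (rule ccontr)
  assume no: "\<not> (\<exists>e\<in>parcs G. x = fst e \<or> x = snd e)"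
  obtain e where e: "e \<in> parcs G" using assms(2) by blast
  have "(x = x) = (fst e = x)"
    by (rule connected_invariant[where P = "\<lambda>z. z = x"]) (use assms no e arc_fst_in_verts in auto)
  then show False using no e by auto
qed

definition arc_share :: "('v \<times> 'v \<Rightarrow> real) \<Rightarrow> 'v set \<Rightarrow> 'v \<times> 'v \<Rightarrow> real" where
  "arc_share \<alpha> S e = of_bool (snd e \<in> S) * \<alpha> e + of_bool (fst e \<in> S) * (1 - \<alpha> e)"

section \<open>Mass and perimeter as sums over arcs\<close>

context pair_digraph
begin

text \<open>Interchange the sums over vertices and over incident arcs. Sums over arcs suit the
  product, whose arcs correspond to pairs of arcs while its vertices are glued.\<close>

lemma vertex_measure_arcs:
  assumes "finite S"
  shows "vertex_measure G \<nu> \<alpha> S = (\<Sum>e\<in>parcs G. pmf \<nu> e * arc_share \<alpha> S e)"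
proof -
  have *: "(\<Sum>x\<in>S. \<Sum>e | e \<in> parcs G \<and> g e = x. f e) = (\<Sum>e\<in>parcs G. of_bool (g e \<in> S) * f e)"
    for g :: "'a \<times> 'a \<Rightarrow> 'a" and f :: "'a \<times> 'a \<Rightarrow> real"
  proof -
    have "(\<Sum>x\<in>S. \<Sum>e | e \<in> parcs G \<and> g e = x. f e) =
        (\<Sum>x\<in>S. \<Sum>e\<in>parcs G. if g e = x then f e else 0)"
      using pair_finite_arcs by (simp add: sum.inter_filter)
    also have "\<dots> = (\<Sum>e\<in>parcs G. \<Sum>x\<in>S. if g e = x then f e else 0)" by (rule sum.swap)
    also have "\<dots> = (\<Sum>e\<in>parcs G. of_bool (g e \<in> S) * f e)"
      using assms by (intro sum.cong) auto
    finally show ?thesis .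
  qed
  show ?thesis
    unfolding vertex_measure_def vertex_mass_def sum.distrib *
    by (simp add: arc_share_def algebra_simps flip: sum.distrib)
qed

lemma Per_arcs:
  "Per G \<nu> d S = (\<Sum>e\<in>parcs G. of_bool ((fst e \<in> S) \<noteq> (snd e \<in> S)) * (pmf \<nu> e / edge_length d e))"
proof -
  have "edge_boundary G S = {e \<in> parcs G. (fst e \<in> S) \<noteq> (snd e \<in> S)}"
  proof -
    \<comment> \<open>As the ends are distinct, one common element means exactly one end in
      \<open>S\<close>.\<close>
    have "card ({x, y} \<inter> S) = 1 \<longleftrightarrow> (x \<in> S) \<noteq> (y \<in> S)" if "(x, y) \<in> parcs G" for x y
      using pair_no_loops[OF that] by (auto simp: Int_insert_left)
    then show ?thesis by (auto simp: edge_boundary_def)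
  qed
  then show ?thesis
    unfolding Per_def using pair_finite_arcs
    by (simp add: sum.inter_filter) (intro sum.cong; simp)
qed

lemma Per_compl: "Per G \<nu> d (pverts G - S) = Per G \<nu> d S"
  unfolding Per_arcs using arc_fst_in_verts arc_snd_in_verts by (intro sum.cong) auto

lemma arc_share_nonneg:
  assumes "\<alpha> \<in> parcs G \<rightarrow>\<^sub>E {0<..<1}" "e \<in> parcs G"
  shows "0 \<le> arc_share \<alpha> S e"
  using PiE_mem[OF assms] by (auto simp: arc_share_def)

lemma vertex_measure_nonneg:
  assumes "finite S" "\<alpha> \<in> parcs G \<rightarrow>\<^sub>E {0<..<1}"
  shows "0 \<le> vertex_measure G \<nu> \<alpha> S"
  unfolding vertex_measure_arcs[OF assms(1)]
  using arc_share_nonneg[OF assms(2)] by (intro sum_nonneg) auto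

text \<open>Every vertex lies on some arc, and a weight strictly between 0 and 1 gives both ends of
  the arc a positive share.\<close>

lemma vertex_measure_pos:
  assumes "Digraph_Component.connected (with_proj G)" "parcs G \<noteq> {}"
    and \<nu>: "set_pmf \<nu> = parcs G" and \<alpha>: "\<alpha> \<in> parcs G \<rightarrow>\<^sub>E {0<..<1}"
    and S: "S \<subseteq> pverts G" "S \<noteq> {}"
  shows "0 < vertex_measure G \<nu> \<alpha> S"
proof -
  obtain x where "x \<in> S" using S by blast
  then obtain e where e: "e \<in> parcs G" "x = fst e \<or> x = snd e"
    using ex_incident_arc assms by blast
  have fin: "finite S" using S pair_finite_verts finite_subset by blast
  have "0 < pmf \<nu> e" using \<nu> e(1) by (simp add: pmf_positive)
  moreover have "0 < arc_share \<alpha> S e"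
    using PiE_mem[OF \<alpha> e(1)] \<open>x \<in> S\<close> e(2)
    by (cases "fst e \<in> S"; cases "snd e \<in> S") (auto simp: arc_share_def)
  ultimately show ?thesis
    unfolding vertex_measure_arcs[OF fin]
    using arc_share_nonneg[OF \<alpha>] pair_finite_arcs e(1)
    by (intro sum_pos2[where i = e]) auto
qed

lemma vertex_measure_compl:
  assumes "set_pmf \<nu> = parcs G" "S \<subseteq> pverts G"
  shows "vertex_measure G \<nu> \<alpha> (pverts G - S) = 1 - vertex_measure G \<nu> \<alpha> S"
proof -
  have fin: "finite S" using assms pair_finite_verts finite_subset by blast
  have "vertex_measure G \<nu> \<alpha> (pverts G - S) + vertex_measure G \<nu> \<alpha> S = (\<Sum>e\<in>parcs G. pmf \<nu> e)"
    using fin pair_finite_verts arc_fst_in_verts arc_snd_in_verts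
    by (simp add: vertex_measure_arcs arc_share_def algebra_simps flip: sum.distrib) (intro sum.cong; auto simp: algebra_simps)
  also have "\<dots> = 1" using assms pair_finite_arcs by (intro sum_pmf_eq_1) auto
  finally show ?thesis by simp
qed

end

lemma Per_nonneg:
  assumes "oriented_graph K" "geodesic_metric K d"
  shows "0 \<le> Per K \<nu> d S"
  unfolding Per_def using edge_length_pos[OF assms]
  by (intro sum_nonneg) (auto simp: edge_boundary_def intro!: divide_nonneg_pos)

section \<open>Decomposition of mass and perimeter over the copies of \<open>G\<close>\<close>

locale weighted_slash_product = metric_slash_product H G s t dH dG
  for H :: "'a pair_pre_digraph" and G :: "'b pair_pre_digraph" and s t :: 'b
    and dH :: "'a \<Rightarrow> 'a \<Rightarrow> real" and dG :: "'b \<Rightarrow> 'b \<Rightarrow> real" +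
  fixes \<nu>H :: "('a \<times> 'a) pmf" and \<nu>G :: "('b \<times> 'b) pmf"
  assumes set_\<nu>H: "set_pmf \<nu>H = parcs H" and set_\<nu>G: "set_pmf \<nu>G = parcs G"
begin

abbreviation "\<nu>K \<equiv> slash_measure H G s t \<nu>H \<nu>G"
abbreviation "dK \<equiv> slash_metric H G s t dH dG"

definition fibre :: "(('a \<times> 'a) \<times> 'b) set set \<Rightarrow> 'a \<times> 'a \<Rightarrow> 'b set" where
  "fibre S e = {u \<in> pverts G. vert e u \<in> S}"

text \<open>The weights are restricted to \<open>parcs G\<close> because the infimum in
  \<open>q_circ\<close> ranges over extensional functions.\<close>

definition fibre_mass ::
    "((('a \<times> 'a) \<times> 'b) set \<times> (('a \<times> 'a) \<times> 'b) set \<Rightarrow> real) \<Rightarrow> (('a \<times> 'a) \<times> 'b) set set \<Rightarrow> 'a \<times> 'a \<Rightarrow> real"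
  where "fibre_mass \<alpha> S e = vertex_measure G \<nu>G (\<lambda>f\<in>parcs G. \<alpha> (slash_edge H G s t e f)) (fibre S e)"

lemma fibre_subset: "fibre S e \<subseteq> pverts G" and finite_fibre: "finite (fibre S e)"
  using G.pair_finite_verts by (auto simp: fibre_def)

lemma fibre_compl: "e \<in> parcs H \<Longrightarrow> fibre (pverts K - S) e = pverts G - fibre S e"
  by (auto simp: fibre_def vert_in)

lemma s_in_fibre: "e \<in> parcs H \<Longrightarrow> s \<in> fibre S e \<longleftrightarrow> fst e \<in> trace S"
  and t_in_fibre: "e \<in> parcs H \<Longrightarrow> t \<in> fibre S e \<longleftrightarrow> snd e \<in> trace S"
  using G.s_in G.t_in by (simp_all add: fibre_def fst_in_trace snd_in_trace)

lemma sum_parcs_slash: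
  "(\<Sum>a\<in>parcs K. h a) = (\<Sum>e\<in>parcs H. \<Sum>f\<in>parcs G. h (slash_edge H G s t e f))"
  unfolding parcs_slash
  by (subst sum.reindex[OF inj_on_slash_edge[OF H.oriented_graph_axioms G.st_graph_axioms]])
    (simp add: sum.cartesian_product case_prod_unfold)

lemma pmf_\<nu>K:
  "e \<in> parcs H \<Longrightarrow> f \<in> parcs G \<Longrightarrow> pmf \<nu>K (slash_edge H G s t e f) = pmf \<nu>H e * pmf \<nu>G f"
  using pmf_slash_measure[OF H.oriented_graph_axioms G.st_graph_axioms set_\<nu>H set_\<nu>G] .

lemma set_\<nu>K: "set_pmf \<nu>K = parcs K"
  by (simp add: slash_measure_def parcs_slash set_\<nu>H set_\<nu>G)

text \<open>The measure of a product arc factors, and its ends lie in \<open>S\<close> exactly when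
  the ends of the corresponding arc of \<open>G\<close> lie in the fibre. Since lengths factor too,
  \<open>Per_slash\<close> holds for the same reason.\<close>

lemma vertex_measure_slash:
  assumes "S \<subseteq> pverts K"
  shows "vertex_measure K \<nu>K \<alpha> S = (\<Sum>e\<in>parcs H. pmf \<nu>H e * fibre_mass \<alpha> S e)"
proof -
  interpret K: pair_digraph K by (rule pair_digraph_slash)
  have "finite S" using assms K.pair_finite_verts finite_subset by blast
  then show ?thesis
    unfolding K.vertex_measure_arcs[OF \<open>finite S\<close>] fibre_mass_def
      G.vertex_measure_arcs[OF finite_fibre] sum_parcs_slash sum_distrib_left
    using G.arc_fst_in_verts G.arc_snd_in_verts
    by (intro sum.cong refl) (simp add: pmf_\<nu>K, simp add: arc_share_def slash_edge_def fibre_def)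
qed

lemma Per_slash:
  "Per K \<nu>K dK S =
    (\<Sum>e\<in>parcs H. pmf \<nu>H e / edge_length dH e * Per G \<nu>G dG (fibre S e))"
proof -
  interpret K: pair_digraph K by (rule pair_digraph_slash)
  show ?thesis
    unfolding K.Per_arcs G.Per_arcs sum_parcs_slash sum_distrib_left
    using G.arc_fst_in_verts G.arc_snd_in_verts
    by (intro sum.cong refl) (simp add: pmf_\<nu>K slash_metric, simp add: slash_edge_def fibre_def)
qed

lemma fibre_mass_compl:
  "e \<in> parcs H \<Longrightarrow> fibre_mass \<alpha> (pverts K - S) e = 1 - fibre_mass \<alpha> S e"
  unfolding fibre_mass_def fibre_compl
  by (intro G.vertex_measure_compl set_\<nu>G fibre_subset)

lemma restrict_fibre:
  assumes "\<alpha> \<in> parcs K \<rightarrow>\<^sub>E {0<..<1}" "e \<in> parcs H"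
  shows "(\<lambda>f\<in>parcs G. \<alpha> (slash_edge H G s t e f)) \<in> parcs G \<rightarrow>\<^sub>E {0<..<1}"
  using PiE_mem[OF assms(1) slash_edge_in[OF assms(2)]] by auto

text \<open>Positivity holds because the fibre contains \<open>s\<close> or \<open>t\<close>; the
  upper bounds come from the complement. The strict bounds put the weight chosen later on cut arcs
  inside (0, 1).\<close>

lemma fibre_mass_bounds:
  assumes \<alpha>: "\<alpha> \<in> parcs K \<rightarrow>\<^sub>E {0<..<1}" and e: "e \<in> parcs H"
  shows "0 \<le> fibre_mass \<alpha> S e" "fibre_mass \<alpha> S e \<le> 1"
    and "fst e \<in> trace S \<or> snd e \<in> trace S \<Longrightarrow> 0 < fibre_mass \<alpha> S e"
    and "fst e \<notin> trace S \<or> snd e \<notin> trace S \<Longrightarrow> fibre_mass \<alpha> S e < 1"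
proof -
  have nonneg: "0 \<le> fibre_mass \<alpha> S e" for S
    unfolding fibre_mass_def using finite_fibre restrict_fibre[OF \<alpha> e] by (rule G.vertex_measure_nonneg)
  have pos: "0 < fibre_mass \<alpha> S e" if "fibre S e \<noteq> {}" for S
    unfolding fibre_mass_def
    by (rule G.vertex_measure_pos[OF G.connected G.arcs_nonempty set_\<nu>G restrict_fibre[OF \<alpha> e] fibre_subset that])
  show "0 \<le> fibre_mass \<alpha> S e" by (rule nonneg)
  show "fibre_mass \<alpha> S e \<le> 1"
    using nonneg[of "pverts K - S"] fibre_mass_compl[OF e, of \<alpha> S] by simp
  show "0 < fibre_mass \<alpha> S e" if "fst e \<in> trace S \<or> snd e \<in> trace S"
    using that e by (intro pos) (auto simp flip: s_in_fibre t_in_fibre)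
  show "fibre_mass \<alpha> S e < 1" if "fst e \<notin> trace S \<or> snd e \<notin> trace S"
  proof -
    have "fibre (pverts K - S) e \<noteq> {}"
      using that e G.s_in G.t_in by (auto simp: fibre_compl simp flip: s_in_fibre t_in_fibre)
    then show ?thesis using pos fibre_mass_compl[OF e, of \<alpha> S] by fastforce
  qed
qed

text \<open>
  On an arc of \<open>H\<close> cut by the trace \<open>T\<close> of \<open>S\<close>, the weight \<open>\<beta>\<close> below is chosen so that \<open>T\<close> receives
  exactly the mass of \<open>S\<close> on the corresponding copy of \<open>G\<close>. Hence the masses of \<open>S\<close> and its
  complement exceed those of \<open>T\<close> and its complement at most by the masses on uncut copies, which are
  controlled by the perimeters there.
\<close>

lemma isoperimetric_slash:
  fixes r p q a :: real
  assumes "0 \<le> r" "0 \<le> p" "r \<le> q * p" "0 \<le> a" "a \<le> 1"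
    and S: "S \<subseteq> pverts K" and \<alpha>: "\<alpha> \<in> parcs K \<rightarrow>\<^sub>E {0<..<1}"
    and interior: "\<And>e A \<beta>. \<lbrakk>e \<in> parcs H; A \<subseteq> pverts G; A \<inter> {s, t} = {}; \<beta> \<in> parcs G \<rightarrow>\<^sub>E {0<..<1}\<rbrakk> \<Longrightarrow>
      r * (pmf \<nu>H e * vertex_measure G \<nu>G \<beta> A) powr a \<le> pmf \<nu>H e / edge_length dH e * Per G \<nu>G dG A"
    and crossing: "\<And>A. \<lbrakk>A \<subseteq> pverts G; card (A \<inter> {s, t}) = 1\<rbrakk> \<Longrightarrow> p \<le> Per G \<nu>G dG A"
    and base: "\<And>T \<beta>. \<lbrakk>T \<subseteq> pverts H; \<beta> \<in> parcs H \<rightarrow>\<^sub>E {0<..<1}\<rbrakk> \<Longrightarrow>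
      q * min (vertex_measure H \<nu>H \<beta> T) (vertex_measure H \<nu>H \<beta> (pverts H - T)) powr a \<le> Per H \<nu>H dH T"
  shows "r * min (vertex_measure K \<nu>K \<alpha> S) (vertex_measure K \<nu>K \<alpha> (pverts K - S)) powr a
    \<le> Per K \<nu>K dK S"
proof -
  define T where "T = trace S"
  define m where "m = fibre_mass \<alpha> S"
  define w where "w e = pmf \<nu>H e / edge_length dH e" for e
  \<comment> \<open>\<open>g e\<close> is the mass on an uncut copy that lies on the wrong side of
    the trace: that of \<open>S\<close> if both ends of \<open>e\<close> are outside
    \<open>T\<close>, that of its complement if both are inside.\<close>
  define g where "g e = (if fst e \<in> T then if snd e \<in> T then pmf \<nu>H e * (1 - m e) else 0
    else if snd e \<in> T then 0 else pmf \<nu>H e * m e)" for e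
  \<comment> \<open>\<open>T\<close> receives the fraction \<beta> of a cut arc with head in
    \<open>T\<close> and 1 - \<beta> of one with tail in \<open>T\<close>; both equal
    \<open>m e\<close>. On uncut arcs 1/2 is just some admissible value.\<close>
  define \<beta> where "\<beta> = (\<lambda>e\<in>parcs H. if (fst e \<in> T) = (snd e \<in> T) then 1 / 2
    else if snd e \<in> T then m e else 1 - m e)"
  define A where "A = vertex_measure H \<nu>H \<beta> T"
  define B where "B = vertex_measure H \<nu>H \<beta> (pverts H - T)"
  have w: "0 \<le> w e" if "e \<in> parcs H" for e
    using edge_length_H_pos[OF that] by (simp add: w_def)
  have m: "0 \<le> m e" "m e \<le> 1" if "e \<in> parcs H" for e
    using fibre_mass_bounds(1,2)[OF \<alpha> that] by (simp_all add: m_def)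
  have m': "0 < m e" "m e < 1" if "e \<in> parcs H" "(fst e \<in> T) \<noteq> (snd e \<in> T)" for e
    using fibre_mass_bounds(3,4)[OF \<alpha> that(1)] that(2) by (auto simp: m_def T_def)
  have g: "0 \<le> g e" if "e \<in> parcs H" for e
    using m[OF that] by (simp add: g_def)
  have T: "T \<subseteq> pverts H" unfolding T_def by (rule trace_subset)
  then have fin: "finite T" using H.pair_finite_verts finite_subset by blast
  have \<beta>: "\<beta> \<in> parcs H \<rightarrow>\<^sub>E {0<..<1}" using m' by (auto simp: \<beta>_def)
  have ends: "fst e \<in> pverts H" "snd e \<in> pverts H" if "e \<in> parcs H" for e
    using that H.arc_fst_in_verts H.arc_snd_in_verts by auto

  have "vertex_measure K \<nu>K \<alpha> S = (\<Sum>e\<in>parcs H. pmf \<nu>H e * m e)"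
    using vertex_measure_slash[OF S] by (simp add: m_def)
  also have "\<dots> \<le> (\<Sum>e\<in>parcs H. pmf \<nu>H e * arc_share \<beta> T e + g e)"
  proof (intro sum_mono)
    fix e assume e: "e \<in> parcs H"
    \<comment> \<open>This settles arcs with both ends in \<open>T\<close>, where \<open>T\<close>
      receives all of \<open>pmf \<nu>H e\<close>. Cut arcs give equality, and arcs outside
      \<open>T\<close> are covered by \<open>g e\<close>.\<close>
    have "pmf \<nu>H e * m e \<le> pmf \<nu>H e" using m[OF e] by (simp add: mult_left_le)
    then show "pmf \<nu>H e * m e \<le> pmf \<nu>H e * arc_share \<beta> T e + g e"
      using e g[OF e] by (auto simp: arc_share_def \<beta>_def g_def algebra_simps)
  qed
  also have "\<dots> = A + (\<Sum>e\<in>parcs H. g e)"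
    by (simp add: A_def H.vertex_measure_arcs[OF fin] sum.distrib)
  finally have upper_S: "vertex_measure K \<nu>K \<alpha> S \<le> A + (\<Sum>e\<in>parcs H. g e)" .

  have "vertex_measure K \<nu>K \<alpha> (pverts K - S) = (\<Sum>e\<in>parcs H. pmf \<nu>H e * (1 - m e))"
    using vertex_measure_slash[of "pverts K - S"] by (simp add: m_def fibre_mass_compl)
  also have "\<dots> \<le> (\<Sum>e\<in>parcs H. pmf \<nu>H e * arc_share \<beta> (pverts H - T) e + g e)"
  proof (intro sum_mono)
    fix e assume e: "e \<in> parcs H"
    have "0 \<le> pmf \<nu>H e * m e" using m[OF e] by simp
    then show "pmf \<nu>H e * (1 - m e) \<le> pmf \<nu>H e * arc_share \<beta> (pverts H - T) e + g e"
      using e g[OF e] ends[OF e] by (auto simp: arc_share_def \<beta>_def g_def algebra_simps)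
  qed
  also have "\<dots> = B + (\<Sum>e\<in>parcs H. g e)"
    using H.pair_finite_verts by (simp add: B_def H.vertex_measure_arcs sum.distrib)
  finally have upper_compl: "vertex_measure K \<nu>K \<alpha> (pverts K - S) \<le> B + (\<Sum>e\<in>parcs H. g e)" .

  have local: "of_bool ((fst e \<in> T) \<noteq> (snd e \<in> T)) * w e * p + r * g e powr a
      \<le> w e * Per G \<nu>G dG (fibre S e)" if e: "e \<in> parcs H" for e
  proof -
    have st: "s \<in> fibre S e \<longleftrightarrow> fst e \<in> T" "t \<in> fibre S e \<longleftrightarrow> snd e \<in> T"
      using s_in_fibre t_in_fibre e by (simp_all add: T_def)
    consider "(fst e \<in> T) \<noteq> (snd e \<in> T)" | "fst e \<notin> T" "snd e \<notin> T" | "fst e \<in> T" "snd e \<in> T"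
      by blast
    then show ?thesis
    proof cases
      case 1
      then have "card (fibre S e \<inter> {s, t}) = 1"
        using st G.s_neq_t by (auto simp: Int_insert_right)
      then have "w e * p \<le> w e * Per G \<nu>G dG (fibre S e)"
        using crossing[OF fibre_subset] w[OF e] by (intro mult_left_mono)
      moreover have "g e = 0" using 1 by (auto simp: g_def)
      ultimately show ?thesis using 1 by simp
    next
      case 2
      then have "fibre S e \<inter> {s, t} = {}" using st by auto
      then show ?thesis
        using interior[OF e fibre_subset _ restrict_fibre[OF \<alpha> e], of S] 2
        by (simp add: g_def w_def m_def fibre_mass_def)
    next
      case 3
      \<comment> \<open>The complement of the fibre has the same perimeter and mass
        \<open>1 - m e\<close>, so the interior bound applies to it.\<close>
      then have "(pverts G - fibre S e) \<inter> {s, t} = {}" using st by auto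
      then show ?thesis
        using interior[OF e _ _ restrict_fibre[OF \<alpha> e], of "pverts G - fibre S e"] 3
          fibre_mass_compl[OF e, of \<alpha> S, unfolded fibre_mass_def fibre_compl[OF e]]
        by (simp add: g_def w_def m_def fibre_mass_def G.Per_compl)
    qed
  qed

  have AB: "0 \<le> A" "0 \<le> B"
    unfolding A_def B_def using fin H.pair_finite_verts \<beta> by (auto intro!: H.vertex_measure_nonneg)
  have G0: "0 \<le> (\<Sum>e\<in>parcs H. g e)" using g by (intro sum_nonneg)
  have KS: "0 \<le> vertex_measure K \<nu>K \<alpha> S" "0 \<le> vertex_measure K \<nu>K \<alpha> (pverts K - S)"
    using S fibre_mass_bounds(1)[OF \<alpha>]
    by (auto simp: vertex_measure_slash intro!: sum_nonneg)
  have "r * min (vertex_measure K \<nu>K \<alpha> S) (vertex_measure K \<nu>K \<alpha> (pverts K - S)) powr a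
      \<le> r * (min A B + (\<Sum>e\<in>parcs H. g e)) powr a"
    using upper_S upper_compl KS \<open>0 \<le> r\<close> \<open>0 \<le> a\<close> by (intro mult_left_mono powr_mono2) auto
  also have "\<dots> \<le> r * (min A B powr a + (\<Sum>e\<in>parcs H. g e powr a))"
  proof -
    have "(min A B + (\<Sum>e\<in>parcs H. g e)) powr a \<le> min A B powr a + (\<Sum>e\<in>parcs H. g e) powr a"
      using AB G0 \<open>a \<le> 1\<close> by (intro powr_add_le) auto
    also have "\<dots> \<le> min A B powr a + (\<Sum>e\<in>parcs H. g e powr a)"
      using powr_sum_le[OF H.pair_finite_arcs g \<open>a \<le> 1\<close>] by simp
    finally show ?thesis using \<open>0 \<le> r\<close> by (rule mult_left_mono)
  qed
  also have "\<dots> \<le> p * Per H \<nu>H dH T + (\<Sum>e\<in>parcs H. r * g e powr a)"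
  proof -
    \<comment> \<open>The factor \<open>q\<close> is spent on the isoperimetric inequality in
      \<open>H\<close>; the factor \<open>p\<close> remains to be paid for by the cut
      copies.\<close>
    have "r * min A B powr a \<le> q * p * min A B powr a"
      using \<open>r \<le> q * p\<close> by (intro mult_right_mono) auto
    also have "\<dots> = p * (q * min A B powr a)" by simp
    also have "\<dots> \<le> p * Per H \<nu>H dH T"
      using base[OF T \<beta>] \<open>0 \<le> p\<close> unfolding A_def B_def by (rule mult_left_mono)
    finally show ?thesis by (simp add: distrib_left sum_distrib_left)
  qed
  also have "\<dots> = (\<Sum>e\<in>parcs H. of_bool ((fst e \<in> T) \<noteq> (snd e \<in> T)) * w e * p + r * g e powr a)"
    unfolding H.Per_arcs sum.distrib sum_distrib_left w_def by (simp add: mult_ac)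
  also have "\<dots> \<le> (\<Sum>e\<in>parcs H. w e * Per G \<nu>G dG (fibre S e))"
    by (intro sum_mono local)
  also have "\<dots> = Per K \<nu>K dK S" by (simp add: Per_slash w_def)
  finally show ?thesis .
qed

end

section \<open>Extended real infima and the final estimate\<close>

lemma ereal_real_cases:
  assumes "0 \<le> x" "x \<le> ereal y"
  obtains z where "x = ereal z" "0 \<le> z"
  using assms by (cases x) auto

lemma iso_ratio_nonneg:
  assumes "oriented_graph K" "geodesic_metric K d"
  shows "0 \<le> iso_ratio \<delta> K \<nu> d \<alpha> S" "0 \<le> iso_ratio' \<delta> K \<nu> d \<alpha> S"
  using Per_nonneg[OF assms] by (simp_all add: iso_ratio_def iso_ratio'_def)

theorem theorem3:
  fixes \<delta> :: real
    and H :: "'a pair_pre_digraph" and G :: "'b pair_pre_digraph" and s t :: 'b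
    and \<nu>H :: "('a \<times> 'a) pmf" and \<nu>G :: "('b \<times> 'b) pmf"
    and dH :: "'a \<Rightarrow> 'a \<Rightarrow> real" and dG :: "'b \<Rightarrow> 'b \<Rightarrow> real"
  assumes "\<delta> \<ge> 1"
    and "oriented_graph H" and "st_graph G s t"
    and "set_pmf \<nu>H = parcs H" and "set_pmf \<nu>G = parcs G"
    and "geodesic_metric H dH" and "geodesic_metric G dG"
    and "dG s t = 1"
  shows "q_const \<delta> (slash_graph H G s t) (slash_measure H G s t \<nu>H \<nu>G) (slash_metric H G s t dH dG)
    \<ge> min (rho_const \<delta> H \<nu>H dH * q_circ \<delta> G s t \<nu>G dG)
          (q_const \<delta> H \<nu>H dH * p_const G s t \<nu>G dG)"
proof -
  interpret H: oriented_graph H by fact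
  interpret G: st_graph G s t by fact
  interpret weighted_slash_product H G s t dH dG \<nu>H \<nu>G
    using assms by unfold_locales
  interpret K: pair_digraph K by (rule pair_digraph_slash)
  define a where "a = (\<delta> - 1) / \<delta>"
  have a: "0 \<le> a" "a \<le> 1" and a_eq: "1 / \<delta> + a = 1"
    using \<open>\<delta> \<ge> 1\<close> by (auto simp: a_def field_simps)
  note nonneg = iso_ratio_nonneg[OF H.oriented_graph_axioms geodesic_H]
    iso_ratio_nonneg[OF G.oriented_graph_axioms geodesic_G]
    Per_nonneg[OF H.oriented_graph_axioms geodesic_H] Per_nonneg[OF G.oriented_graph_axioms geodesic_G]

  \<comment> \<open>To see that the constant of \<open>H\<close> is finite, one proper nonempty set
    and one admissible weight suffice. The tail of an arc works, as the head is a different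
    vertex.\<close>
  have half: "(\<lambda>e\<in>parcs H. 1 / 2) \<in> parcs H \<rightarrow>\<^sub>E {0<..<1::real}" by auto
  obtain e0 where e0: "e0 \<in> parcs H" using H.arcs_nonempty by blast
  have single: "{fst e0} \<noteq> {} \<and> {fst e0} \<subset> pverts H"
    using H.arc_fst_in_verts[OF e0] H.arc_snd_in_verts[OF e0] H.pair_no_loops[OF e0]
    by (metis empty_subsetI insert_not_empty insert_subset psubsetI singletonD)
  have "0 \<le> q_const \<delta> H \<nu>H dH"
    unfolding q_const_def using nonneg by (intro INF_greatest) simp
  moreover have "q_const \<delta> H \<nu>H dH \<le> ereal (iso_ratio \<delta> H \<nu>H dH (\<lambda>e\<in>parcs H. 1 / 2) {fst e0})"
    unfolding q_const_def using single half by (intro INF_lower2[of "{fst e0}"] INF_lower) auto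
  ultimately obtain q where q: "q_const \<delta> H \<nu>H dH = ereal q" "0 \<le> q"
    by (rule ereal_real_cases)
  have "0 \<le> p_const G s t \<nu>G dG"
    unfolding p_const_def using nonneg by (intro INF_greatest) simp
  moreover have "p_const G s t \<nu>G dG \<le> ereal (Per G \<nu>G dG {s})"
    unfolding p_const_def using G.s_in by (intro INF_lower) auto
  ultimately obtain p where p: "p_const G s t \<nu>G dG = ereal p" "0 \<le> p"
    by (rule ereal_real_cases)
  \<comment> \<open>\<open>q'\<close> is infinite when \<open>s\<close> and \<open>t\<close> are the
    only vertices of \<open>G\<close>, so only the minimum, which is at most \<open>q * p\<close>,
    is turned into a real number.\<close>
  define \<rho> where "\<rho> = rho_const \<delta> H \<nu>H dH"
  define q' where "q' = q_circ \<delta> G s t \<nu>G dG"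
  have \<rho>: "0 \<le> \<rho>"
    unfolding \<rho>_def rho_const_def
    using edge_length_H_pos by (intro INF_greatest) (simp add: order.strict_implies_order)
  have q': "0 \<le> q'"
    unfolding q'_def q_circ_def using nonneg by (intro INF_greatest) simp
  have "0 \<le> min (\<rho> * q') (ereal q * ereal p)"
    using \<rho> q' q p by simp
  moreover have "min (\<rho> * q') (ereal q * ereal p) \<le> ereal (q * p)" by simp
  ultimately obtain r where r: "min (\<rho> * q') (ereal q * ereal p) = ereal r" "0 \<le> r"
    by (rule ereal_real_cases)
  have r_qp: "r \<le> q * p" and r_\<rho>: "ereal r \<le> \<rho> * q'"
    unfolding ereal_less_eq(3)[symmetric] r(1)[symmetric] by simp_all

  have base: "q * min (vertex_measure H \<nu>H \<beta> T) (vertex_measure H \<nu>H \<beta> (pverts H - T)) powr a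
      \<le> Per H \<nu>H dH T" if T: "T \<subseteq> pverts H" and \<beta>: "\<beta> \<in> parcs H \<rightarrow>\<^sub>E {0<..<1}" for T \<beta>
  proof (cases "T = {} \<or> T = pverts H")
    case True
    have "finite T" using T H.pair_finite_verts finite_subset by blast
    then have "0 \<le> vertex_measure H \<nu>H \<beta> T" using \<beta> by (rule H.vertex_measure_nonneg)
    moreover have "vertex_measure H \<nu>H \<beta> {} = 0" by (simp add: vertex_measure_def)
    ultimately have "min (vertex_measure H \<nu>H \<beta> T) (vertex_measure H \<nu>H \<beta> (pverts H - T)) = 0"
      using True H.vertex_measure_nonneg[OF H.pair_finite_verts \<beta>] by auto
    \<comment> \<open>The left side vanishes even for \<delta> = 1, because
      \<open>0 powr 0 = 0\<close>.\<close>
    then show ?thesis using nonneg by simp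
  next
    case False
    then have "T \<noteq> {} \<and> T \<subset> pverts H" using T by blast
    then have "ereal q \<le> ereal (iso_ratio \<delta> H \<nu>H dH \<beta> T)"
      unfolding q(1)[symmetric] q_const_def using \<beta> by (intro INF_lower2[of T] INF_lower) auto
    moreover have "0 < vertex_measure H \<nu>H \<beta> T" "0 < vertex_measure H \<nu>H \<beta> (pverts H - T)"
      using False T by (auto intro!: H.vertex_measure_pos H.connected H.arcs_nonempty set_\<nu>H \<beta>)
    ultimately show ?thesis
      by (simp add: iso_ratio_def a_def pos_le_divide_eq)
  qed
  have crossing: "p \<le> Per G \<nu>G dG A" if "A \<subseteq> pverts G" "card (A \<inter> {s, t}) = 1" for A
  proof -
    have "ereal p \<le> ereal (Per G \<nu>G dG A)"
      unfolding p(1)[symmetric] p_const_def using that by (intro INF_lower) auto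
    then show ?thesis by simp
  qed
  have interior: "r * (pmf \<nu>H e * vertex_measure G \<nu>G \<beta> A) powr a
      \<le> pmf \<nu>H e / edge_length dH e * Per G \<nu>G dG A"
    if e: "e \<in> parcs H" and A: "A \<subseteq> pverts G" "A \<inter> {s, t} = {}"
      and \<beta>: "\<beta> \<in> parcs G \<rightarrow>\<^sub>E {0<..<1}" for e A \<beta>
  proof (cases "A = {}")
    case True
    then show ?thesis
      using nonneg edge_length_H_pos[OF e] by (simp add: vertex_measure_def)
  next
    case False
    let ?m = "vertex_measure G \<nu>G \<beta> A"
    have m: "0 < ?m"
      using G.vertex_measure_pos[OF G.connected G.arcs_nonempty set_\<nu>G \<beta> A(1) False] .
    have \<nu>: "0 < pmf \<nu>H e" using e set_\<nu>H by (simp add: pmf_positive)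
    have "\<rho> \<le> ereal (pmf \<nu>H e powr (1 / \<delta>) / edge_length dH e)"
      unfolding \<rho>_def rho_const_def using e by (intro INF_lower)
    moreover have "q' \<le> ereal (iso_ratio' \<delta> G \<nu>G dG \<beta> A)"
      unfolding q'_def q_circ_def using A False \<beta> by (intro INF_lower2[of A] INF_lower) auto
    ultimately have "\<rho> * q' \<le> ereal (pmf \<nu>H e powr (1 / \<delta>) / edge_length dH e) *
        ereal (iso_ratio' \<delta> G \<nu>G dG \<beta> A)"
      using q' edge_length_H_pos[OF e] by (intro ereal_mult_mono) auto
    with r_\<rho> have "ereal r \<le> ereal (pmf \<nu>H e powr (1 / \<delta>) / edge_length dH e) *
        ereal (iso_ratio' \<delta> G \<nu>G dG \<beta> A)"
      by (rule order_trans)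
    then have "r \<le> pmf \<nu>H e powr (1 / \<delta>) / edge_length dH e * (Per G \<nu>G dG A / ?m powr a)"
      by (simp add: iso_ratio'_def a_def)
    \<comment> \<open>Multiplying by these powers clears the denominator, and
      \<open>1 / \<delta> + a = 1\<close> restores the full weight
      \<open>pmf \<nu>H e\<close>.\<close>
    then have "r * (pmf \<nu>H e powr a * ?m powr a) \<le>
        pmf \<nu>H e powr (1 / \<delta>) / edge_length dH e * (Per G \<nu>G dG A / ?m powr a) *
        (pmf \<nu>H e powr a * ?m powr a)"
      by (intro mult_right_mono) auto
    also have "\<dots> = (pmf \<nu>H e powr (1 / \<delta>) * pmf \<nu>H e powr a) / edge_length dH e * Per G \<nu>G dG A"
      using m by simp
    also have "pmf \<nu>H e powr (1 / \<delta>) * pmf \<nu>H e powr a = pmf \<nu>H e"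
      using \<nu> by (simp add: a_eq flip: powr_add)
    finally show ?thesis using \<nu> m by (simp add: powr_mult)
  qed

  have "ereal r \<le> ereal (iso_ratio \<delta> K \<nu>K dK \<alpha> S)"
    if S: "S \<noteq> {}" "S \<subset> pverts K" and \<alpha>: "\<alpha> \<in> parcs K \<rightarrow>\<^sub>E {0<..<1}" for S \<alpha>
  proof -
    have "parcs K \<noteq> {}" using H.arcs_nonempty G.arcs_nonempty by (auto simp: parcs_slash)
    then have "0 < vertex_measure K \<nu>K \<alpha> S" "0 < vertex_measure K \<nu>K \<alpha> (pverts K - S)"
      using S by (auto intro!: K.vertex_measure_pos connected_slash set_\<nu>K \<alpha>)
    moreover have "r * min (vertex_measure K \<nu>K \<alpha> S) (vertex_measure K \<nu>K \<alpha> (pverts K - S)) powr a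
        \<le> Per K \<nu>K dK S"
      using S by (intro isoperimetric_slash[OF r(2) p(2) r_qp a _ \<alpha> interior crossing base]) auto
    ultimately show ?thesis by (simp add: iso_ratio_def a_def pos_le_divide_eq)
  qed
  then have "ereal r \<le> q_const \<delta> K \<nu>K dK"
    unfolding q_const_def by (intro INF_greatest) auto
  then show ?thesis
    unfolding q(1) p(1) \<rho>_def[symmetric] q'_def[symmetric] r(1) .
qed

end
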